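(* In the variable-assignment setting, suppose that $\mathcal B$ satisfies Shearer's criterion. Let $\mathcal A=\{A_1,\dots,A_m\}$ be a finite set of events in the probability space $\Omega$, enumerated in an arbitrary order, and let $\vee\mathcal A = A_1\cup\dots\cup A_m$. Then $$\Pr_{\mathrm{MT}}(\vee\mathcal A)\ \le\ \sum_{j=1}^m \Pr_{\Omega}\bigl(A_j\wedge\neg A_1\wedge\dots\wedge\neg A_{j-1}\bigr)\,\Psi_{\mathcal B[\vee\mathcal A]}(A_j).$$
   Context: Variable-assignment setting: $\Omega$ is a product probability space with independent random variables $X(1),\dots,X(n)$. Every event $E$ considered is a boolean function of the variables in a specified subset $\mathrm{var}(E)\subseteq\{1,\dots,n\}$, and $E\sim E'$ means $\mathrm{var}(E)\cap\mathrm{var}(E')\ne\emptyset$. $\mathcal B$ is a finite collection of events (the bad-events). For an event $E$, $N(E)=\{B\in\mathcal B: B\sim E\}$ (for $B\in\mathcal B$ this is the inclusive neighborhood, so $B\in N(B)$). A set $I\subseteq\mathcal B$ is stable if no two distinct $B,B'\in I$ satisfy $B\sim B'$. For a subfamily $\mathcal C\subseteq\mathcal B$ and $I\subseteq\mathcal C$ let $$Q_{\mathcal C}(I)=\sum_{I\subseteq J\subseteq\mathcal C,\ J\text{ stable}}(-1)^{|J|-|I|}\prod_{B\in J}\Pr_\Omega(B).$$ Shearer's criterion for $\mathcal B$: $Q_{\mathcal B}(I)>0$ for all stable $I\subseteq\mathcal B$. (It is then also satisfied by every subfamily.) Under it, $\mu_{\mathcal C}(I)=Q_{\mathcal C}(I)/Q_{\mathcal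 C}(\emptyset)$ and, for an event $E$, $\Psi_{\mathcal C}(E)=\sum_{J\subseteq N(E)\cap\mathcal C}\mu_{\mathcal C}(J)$. For an event $E$, $\mathcal B[E]$ is the set of $B\in\mathcal B$ with $\Pr_\Omega(E\mid B)<1$. MT (Moser–Tardos) algorithm: draw $X\sim\Omega$; while some $B\in\mathcal B$ is true on $X$, choose some true $B\in\mathcal B$ (by an arbitrary fixed, possibly randomized, rule) and resample all variables in $\mathrm{var}(B)$ independently from their distributions in $\Omega$. Under Shearer's criterion it terminates with probability one. $\Pr_{\mathrm{MT}}$ denotes probability with respect to the distribution of $X$ at termination; the result holds for every choice of selection rule. *)

theory Defs
  imports "HOL-Probability.Probability"
begin

text \<open>
  A configuration assigns a value to each of the variables \<open>X(1), \<dots>, X(n)\<close>; configurations are the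
  points of \<open>\<Omega> = PiM {1..n} M\<close>, where \<open>M i\<close> is the distribution of \<open>X(i)\<close>.
  An event carries its specified variable set, which need not be the smallest possible one.
\<close>

type_synonym 'v config = "nat \<Rightarrow> 'v"

datatype 'v event = Event (occ: "'v config set") (var: "nat set")

definition is_event :: "nat \<Rightarrow> 'v config measure \<Rightarrow> 'v event \<Rightarrow> bool" where
  "is_event n \<Omega> E \<longleftrightarrow> var E \<subseteq> {1..n} \<and> occ E \<in> sets \<Omega> \<and>
     (\<forall>x\<in>space \<Omega>. \<forall>y\<in>space \<Omega>. (\<forall>i\<in>var E. x i = y i) \<longrightarrow> (x \<in> occ E \<longleftrightarrow> y \<in> occ E))"

definition dep :: "'v event \<Rightarrow> 'v event \<Rightarrow> bool" where
  "dep E E' \<longleftrightarrow> var E \<inter> var E' \<noteq> {}"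

definition nbhd :: "'v event set \<Rightarrow> 'v event \<Rightarrow> 'v event set" where
  "nbhd \<B> E = {B\<in>\<B>. dep B E}"

definition stable :: "'v event set \<Rightarrow> bool" where
  "stable I \<longleftrightarrow> (\<forall>B\<in>I. \<forall>B'\<in>I. B \<noteq> B' \<longrightarrow> \<not> dep B B')"

definition Q :: "'v config measure \<Rightarrow> 'v event set \<Rightarrow> 'v event set \<Rightarrow> real" where
  "Q \<Omega> \<C> I = (\<Sum>J | I \<subseteq> J \<and> J \<subseteq> \<C> \<and> stable J.
                (-1) ^ (card J - card I) * (\<Prod>B\<in>J. measure \<Omega> (occ B)))"

definition shearer :: "'v config measure \<Rightarrow> 'v event set \<Rightarrow> bool" where
  "shearer \<Omega> \<B> \<longleftrightarrow> (\<forall>I. I \<subseteq> \<B> \<and> stable I \<longrightarrow> Q \<Omega> \<B> I > 0)"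

definition mu :: "'v config measure \<Rightarrow> 'v event set \<Rightarrow> 'v event set \<Rightarrow> real" where
  "mu \<Omega> \<C> I = Q \<Omega> \<C> I / Q \<Omega> \<C> {}"

definition Psi :: "'v config measure \<Rightarrow> 'v event set \<Rightarrow> 'v event set \<Rightarrow> 'v event \<Rightarrow> real" where
  "Psi \<Omega> \<B> \<C> E = (\<Sum>J | J \<subseteq> nbhd \<B> E \<inter> \<C>. mu \<Omega> \<C> J)"

text \<open>
  The family \<open>\<B>[E]\<close>. Bad-events of probability \<open>0\<close>, for which the conditional probability is
  \<open>0\<close> by the convention for division, are excluded by Shearer's criterion.
\<close>

definition restrict_bad :: "'v config measure \<Rightarrow> 'v event set \<Rightarrow> 'v event \<Rightarrow> 'v event set" where
  "restrict_bad \<Omega> \<B> E = {B\<in>\<B>. \<P>(x in \<Omega>. x \<in> occ E \<bar> x \<in> occ B) < 1}"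

definition Disj :: "'v event set \<Rightarrow> 'v event" where
  "Disj \<A> = Event (\<Union>A\<in>\<A>. occ A) (\<Union>A\<in>\<A>. var A)"

text \<open>
  The Moser--Tardos algorithm. The list argument of a selection rule is the history of
  configurations in chronological order, so that the current one comes last; the argument in
  \<open>'s\<close> is a random seed, drawn from \<open>S\<close> once and independently of all variable draws, that supplies
  the randomness of the rule for the whole run. Given the seed, earlier selections are determined by
  the earlier configurations, so a rule may depend on those as well. What a rule returns when no
  bad-event is true on the current configuration is never used.
\<close>

type_synonym ('s, 'v) rule = "'s \<Rightarrow> 'v config list \<Rightarrow> 'v event"

definition selection_rule ::
    "'v config measure \<Rightarrow> 's measure \<Rightarrow> 'v event set \<Rightarrow> ('s, 'v) rule \<Rightarrow> bool" where
  "selection_rule \<Omega> S \<B> r \<longleftrightarrow>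
     (\<forall>s\<in>space S. \<forall>h. h \<noteq> [] \<and> set h \<subseteq> space \<Omega> \<and> (\<exists>B\<in>\<B>. last h \<in> occ B) \<longrightarrow>
        r s h \<in> \<B> \<and> last h \<in> occ (r s h)) \<and>
     (\<forall>t::nat. \<forall>B\<in>\<B>. {(s, x) \<in> space (S \<Otimes>\<^sub>M (\<Pi>\<^sub>M k\<in>{..t}. \<Omega>)). r s (map x [0..<Suc t]) = B}
        \<in> sets (S \<Otimes>\<^sub>M (\<Pi>\<^sub>M k\<in>{..t}. \<Omega>)))"

text \<open>
  A run is a function of the seed and of independent draws \<open>y 0, y 1, \<dots>\<close> from \<open>\<Omega>\<close>: \<open>y 0\<close> is the
  initial configuration, and the resampling in step \<open>t + 1\<close> takes the new values of the variables
  of the selected bad-event from \<open>y (t + 1)\<close>. After termination the configuration stays constant.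
\<close>

primrec mt_history ::
    "'v event set \<Rightarrow> ('s, 'v) rule \<Rightarrow> 's \<Rightarrow> (nat \<Rightarrow> 'v config) \<Rightarrow> nat \<Rightarrow> 'v config list" where
  "mt_history \<B> r s y 0 = [y 0]"
| "mt_history \<B> r s y (Suc t) =
     (let h = mt_history \<B> r s y t; x = last h
      in h @ [if \<exists>B\<in>\<B>. x \<in> occ B then override_on x (y (Suc t)) (var (r s h)) else x])"

definition mt_config ::
    "'v event set \<Rightarrow> ('s, 'v) rule \<Rightarrow> 's \<Rightarrow> (nat \<Rightarrow> 'v config) \<Rightarrow> nat \<Rightarrow> 'v config" where
  "mt_config \<B> r s y t = last (mt_history \<B> r s y t)"

text \<open>
  The probability that the algorithm terminates in a configuration on which \<open>E\<close> is true. Under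
  Shearer's criterion termination has probability one.
\<close>

definition mt_prob ::
    "'v config measure \<Rightarrow> 's measure \<Rightarrow> 'v event set \<Rightarrow> ('s, 'v) rule \<Rightarrow> 'v event \<Rightarrow> real" where
  "mt_prob \<Omega> S \<B> r E =
     \<P>((s, y) in S \<Otimes>\<^sub>M (\<Pi>\<^sub>M t\<in>(UNIV::nat set). \<Omega>).
        \<exists>t. (\<forall>B\<in>\<B>. mt_config \<B> r s y t \<notin> occ B) \<and> mt_config \<B> r s y t \<in> occ E)"

end

theory Submission
  imports Defs
begin

text \<open>
  Give every variable an infinite column of independent values, so that resampling moves one step down
  the column. Let \<open>E\<close> be the union of the targets. Up to null sets the algorithm selects only
  bad-events of \<open>\<C> = \<B>[E]\<close> before its first visit to \<open>E\<close>, hence it visits \<open>E\<close> with at most the probability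
  that some legal sequence of resamplings of events of \<open>\<C>\<close> leads the table into \<open>E\<close>: whatever the
  selection rule, the latter probability, conditioned on the past, never increases during the run.

  If such a sequence exists, take one that ends in \<open>A\<^sub>j\<close> with \<open>j\<close> least, and then a shortest one. It ends in
  \<open>A\<^sub>j \<and> \<not>A\<^sub>1 \<and> \<dots> \<and> \<not>A\<^sub>j\<^sub>-\<^sub>1\<close>, and each of its letters shares a variable with a later one or with \<open>A\<^sub>j\<close>,
  since otherwise it could be dropped. Its letters can thus be arranged in stable layers, the topmost inside
  \<open>N(A\<^sub>j)\<close> and each further one inside the neighborhood of the layer above. The conditions of a fixed
  layering concern disjoint parts of the table, so their probability is a product, and the recurrence
  \<open>\<mu>(I) = Pr(I) \<Sum>\<^bsub>K \<subseteq> N(I)\<^esub> \<mu>(K)\<close> bounds the sum of these products by \<open>\<Psi>\<^bsub>\<C>\<^esub>(A\<^sub>j)\<close>.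
\<close>

section \<open>Shearer's polynomial and layerings\<close>

text \<open>The disjunct \<open>B = B'\<close> is there for events with an empty variable set, for
  which \<open>dep B B\<close> fails; it makes every \<open>I \<subseteq> \<C>\<close> part of its
  own neighborhood.\<close>

definition closed_nbhd :: "'v event set \<Rightarrow> 'v event set \<Rightarrow> 'v event set" where
  "closed_nbhd \<C> I = {B\<in>\<C>. \<exists>B'\<in>I. B = B' \<or> dep B B'}"

lemma dep_sym: "dep B B' \<longleftrightarrow> dep B' B"
  by (auto simp: dep_def)

lemma stable_subset: "stable J \<Longrightarrow> I \<subseteq> J \<Longrightarrow> stable I"
  by (auto simp: stable_def)

section \<open>Summation formulas for Shearer's polynomial\<close>

lemma sum_alternating_Pow:
  "finite K \<Longrightarrow> (\<Sum>I\<in>Pow K. (-1) ^ card I :: real) = (if K = {} then 1 else 0)"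
  using prod_diff_conv_sum[of K "\<lambda>_. 1 :: real" "\<lambda>_. 1"] by (auto simp: card_eq_0_iff power_0_left)

text \<open>After the sums are exchanged, a stable \<open>J\<close> carries the alternating sum over
  the subsets of \<open>J \<inter> U\<close>, which vanishes unless \<open>J\<close> misses
  \<open>U\<close>.\<close>

lemma sum_Q_subsets:
  assumes "finite \<C>" "U \<subseteq> \<C>"
  shows "(\<Sum>I\<in>Pow U. Q \<Omega> \<C> I) = Q \<Omega> (\<C> - U) {}"
proof -
  define p where "p J = (\<Prod>B\<in>J. measure \<Omega> (occ B))" for J :: "'a event set"
  define F where "F = {J. J \<subseteq> \<C> \<and> stable J}"
  have finF: "finite F" and finC: "\<And>J. J \<in> F \<Longrightarrow> finite J"
    using assms(1) by (auto simp: F_def intro: finite_subset)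
  have finU: "finite (Pow U)" using assms finite_subset by auto
  have "(\<Sum>I\<in>Pow U. Q \<Omega> \<C> I) = (\<Sum>I\<in>Pow U. \<Sum>J | J \<in> F \<and> I \<subseteq> J. (-1) ^ (card J - card I) * p J)"
    unfolding Q_def p_def F_def by (intro sum.cong) auto
  also have "\<dots> = (\<Sum>J\<in>F. \<Sum>I | I \<in> Pow U \<and> I \<subseteq> J. (-1) ^ (card J - card I) * p J)"
    by (rule sum.swap_restrict[OF finU finF])
  also have "\<dots> = (\<Sum>J\<in>F. if J \<inter> U = {} then (-1) ^ card J * p J else 0)"
  proof (rule sum.cong[OF refl])
    fix J assume J: "J \<in> F"
    have "(\<Sum>I | I \<in> Pow U \<and> I \<subseteq> J. (-1) ^ (card J - card I) * p J)
        = (\<Sum>I\<in>Pow (J \<inter> U). (-1) ^ card I * ((-1) ^ card J * p J))"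
    proof (rule sum.cong)
      fix I assume "I \<in> Pow (J \<inter> U)"
      hence "card I \<le> card J" using finC[OF J] by (auto intro: card_mono)
      hence "(-1::real) ^ (card J - card I) = (-1) ^ card I * (-1) ^ card J"
        by (auto simp: power_diff_conv_inverse power_mult_distrib[symmetric] minus_one_power_iff)
      thus "(-1) ^ (card J - card I) * p J = (-1) ^ card I * ((-1) ^ card J * p J)" by simp
    qed auto
    also have "\<dots> = (if J \<inter> U = {} then (-1) ^ card J * p J else 0)"
      using sum_alternating_Pow[of "J \<inter> U"] finC[OF J] by (simp add: sum_distrib_right[symmetric])
    finally show "(\<Sum>I | I \<in> Pow U \<and> I \<subseteq> J. (-1) ^ (card J - card I) * p J)
        = (if J \<inter> U = {} then (-1) ^ card J * p J else 0)" .
  qed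
  also have "\<dots> = (\<Sum>J | J \<in> F \<and> J \<inter> U = {}. (-1) ^ card J * p J)"
    by (rule sum.inter_filter[OF finF, symmetric])
  also have "\<dots> = Q \<Omega> (\<C> - U) {}"
    unfolding Q_def p_def F_def by (intro sum.cong) auto
  finally show ?thesis .
qed

lemma Q_unstable: "\<not> stable I \<Longrightarrow> Q \<Omega> \<C> I = 0"
  unfolding Q_def by (rule sum.neutral) (auto dest: stable_subset)

text \<open>The stable sets containing \<open>I\<close> are the sets \<open>K \<union> I\<close>
  with \<open>K\<close> stable and outside the closed neighborhood of \<open>I\<close>; the product
  factors, and the sign depends on \<open>card K\<close> alone.\<close>

lemma Q_stable:
  assumes "finite \<C>" "I \<subseteq> \<C>" "stable I"
  shows "Q \<Omega> \<C> I = (\<Prod>B\<in>I. measure \<Omega> (occ B)) * Q \<Omega> (\<C> - closed_nbhd \<C> I) {}"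
proof -
  have fin: "finite J" if "J \<subseteq> \<C>" for J using that assms(1) finite_subset by auto
  have "(\<Sum>J | I \<subseteq> J \<and> J \<subseteq> \<C> \<and> stable J.
          (-1) ^ (card J - card I) * (\<Prod>B\<in>J. measure \<Omega> (occ B)))
    = (\<Sum>K | K \<subseteq> \<C> - closed_nbhd \<C> I \<and> stable K.
        (\<Prod>B\<in>I. measure \<Omega> (occ B)) * ((-1) ^ card K * (\<Prod>B\<in>K. measure \<Omega> (occ B))))"
  proof (rule sum.reindex_bij_witness[where i="\<lambda>K. K \<union> I" and j="\<lambda>J. J - I"])
    fix J assume J: "J \<in> {J. I \<subseteq> J \<and> J \<subseteq> \<C> \<and> stable J}"
    show "J - I \<union> I = J" using J by auto
    have "\<not> dep B B'" if "B \<in> J - I" "B' \<in> I" for B B'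
    proof -
      have "B \<in> J" "B' \<in> J" "B \<noteq> B'" using J that by auto
      thus ?thesis using J by (simp add: stable_def)
    qed
    thus "J - I \<in> {K. K \<subseteq> \<C> - closed_nbhd \<C> I \<and> stable K}"
      using J stable_subset[of J "J - I"] by (auto simp: closed_nbhd_def)
    have "card (J - I) = card J - card I" using J by (intro card_Diff_subset fin) auto
    moreover have "(\<Prod>B\<in>J. measure \<Omega> (occ B))
        = (\<Prod>B\<in>J - I. measure \<Omega> (occ B)) * (\<Prod>B\<in>I. measure \<Omega> (occ B))"
      using J by (intro prod.subset_diff fin) auto
    ultimately show "(\<Prod>B\<in>I. measure \<Omega> (occ B)) *
        ((-1) ^ card (J - I) * (\<Prod>B\<in>J - I. measure \<Omega> (occ B)))
      = (-1) ^ (card J - card I) * (\<Prod>B\<in>J. measure \<Omega> (occ B))" by simp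
  next
    fix K assume K: "K \<in> {K. K \<subseteq> \<C> - closed_nbhd \<C> I \<and> stable K}"
    show "K \<union> I - I = K" using K assms(2) by (auto simp: closed_nbhd_def)
    show "K \<union> I \<in> {J. I \<subseteq> J \<and> J \<subseteq> \<C> \<and> stable J}"
    proof -
      have "\<not> dep B B'" "\<not> dep B' B" if "B \<in> K" "B' \<in> I" for B B'
        using K that dep_sym[of B B'] by (auto simp: closed_nbhd_def)
      thus ?thesis using K assms(2,3) by (auto simp: stable_def)
    qed
  qed
  thus ?thesis by (simp add: Q_def sum_distrib_left)
qed

text \<open>\<open>sum_Q_subsets\<close> with \<open>U = \<B> - \<C>\<close> writes
  \<open>Q \<Omega> \<C> {}\<close> as a sum of terms \<open>Q \<Omega> \<B> I\<close>, none of them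
  negative and the one for \<open>{}\<close> positive.\<close>

lemma Q_empty_pos:
  assumes "finite \<B>" "shearer \<Omega> \<B>" "\<C> \<subseteq> \<B>"
  shows "Q \<Omega> \<C> {} > 0"
proof -
  have fin: "finite (Pow (\<B> - \<C>))" using assms(1) by auto
  have nonneg: "Q \<Omega> \<B> I \<ge> 0" if "I \<subseteq> \<B>" for I
    using that assms(2) Q_unstable[of I] by (cases "stable I") (auto simp: shearer_def intro: less_imp_le)
  have "0 < Q \<Omega> \<B> {}" using assms(2) by (auto simp: shearer_def stable_def)
  also have "\<dots> \<le> (\<Sum>I\<in>Pow (\<B> - \<C>). Q \<Omega> \<B> I)"
    using member_le_sum[of "{}" "Pow (\<B> - \<C>)" "Q \<Omega> \<B>"] fin nonneg by auto
  also have "\<dots> = Q \<Omega> \<C> {}"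
    using sum_Q_subsets[OF assms(1), of "\<B> - \<C>"] assms(3) by (simp add: double_diff)
  finally show ?thesis .
qed

lemma mu_nonneg:
  assumes "finite \<B>" "shearer \<Omega> \<B>" "\<C> \<subseteq> \<B>" "I \<subseteq> \<C>"
  shows "mu \<Omega> \<C> I \<ge> 0"
proof (cases "stable I")
  case True
  have "Q \<Omega> (\<C> - closed_nbhd \<C> I) {} > 0"
    using assms by (intro Q_empty_pos[of \<B>]) auto
  thus ?thesis
    using Q_stable[OF _ assms(4) True] Q_empty_pos[OF assms(1-3)] finite_subset[OF assms(3,1)]
    by (auto simp: mu_def intro!: divide_nonneg_pos mult_nonneg_nonneg prod_nonneg)
qed (simp add: mu_def Q_unstable)

text \<open>\<open>sum_Q_subsets\<close> turns the last factor in \<open>Q_stable\<close> back into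
  a sum of \<open>Q \<Omega> \<C> K\<close> over subsets \<open>K\<close> of the neighborhood; then
  everything is divided by \<open>Q \<Omega> \<C> {}\<close>.\<close>

lemma mu_recurrence:
  assumes "finite \<C>" "I \<subseteq> \<C>" "stable I"
  shows "mu \<Omega> \<C> I = (\<Prod>B\<in>I. measure \<Omega> (occ B)) * (\<Sum>K\<in>Pow (closed_nbhd \<C> I). mu \<Omega> \<C> K)"
  using sum_Q_subsets[OF assms(1), of "closed_nbhd \<C> I" \<Omega>] Q_stable[OF assms]
  by (auto simp: mu_def closed_nbhd_def sum_divide_distrib[symmetric])

text \<open>Layers are listed from the last to the first one resampled.\<close>

fun layerings :: "'v event set \<Rightarrow> nat \<Rightarrow> 'v event set \<Rightarrow> 'v event set list set" where
  "layerings \<C> 0 U = {[]}"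
| "layerings \<C> (Suc d) U =
    (\<Union>I\<in>{I. I \<subseteq> U \<inter> \<C> \<and> stable I}. (#) I ` layerings \<C> d (closed_nbhd \<C> I))"

definition weight :: "'v config measure \<Rightarrow> 'v event set list \<Rightarrow> real" where
  "weight \<Omega> L = (\<Prod>I\<leftarrow>L. \<Prod>B\<in>I. measure \<Omega> (occ B))"

lemma finite_layerings: "finite \<C> \<Longrightarrow> finite (layerings \<C> d U)"
  by (induction d arbitrary: U) (auto intro!: finite_subset[of _ "Pow \<C>"])

text \<open>With the top layer \<open>I\<close> split off and the induction hypothesis applied to
  the rest, the right side of \<open>mu_recurrence\<close> appears, so \<open>I\<close> contributes
  at most \<open>mu \<Omega> \<C> I\<close>. At depth 0 the empty list has weight 1, which is
  \<open>mu \<Omega> \<C> {}\<close>.\<close>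

lemma sum_weight_layerings:
  assumes "finite \<B>" "shearer \<Omega> \<B>" "\<C> \<subseteq> \<B>"
  shows "(\<Sum>L\<in>layerings \<C> d U. weight \<Omega> L) \<le> (\<Sum>I\<in>Pow (U \<inter> \<C>). mu \<Omega> \<C> I)"
proof (induction d arbitrary: U)
  case 0
  have "mu \<Omega> \<C> {} = 1" using Q_empty_pos[OF assms] by (simp add: mu_def)
  thus ?case
    using member_le_sum[of "{}" "Pow (U \<inter> \<C>)" "mu \<Omega> \<C>"] mu_nonneg[OF assms] finite_subset[OF assms(3,1)]
    by (auto simp: weight_def)
next
  case (Suc d)
  have finC: "finite \<C>" using assms finite_subset by auto
  let ?S = "{I. I \<subseteq> U \<inter> \<C> \<and> stable I}"
  have finS: "finite ?S" using finC by (auto intro: finite_subset[of _ "Pow \<C>"])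
  have "(\<Sum>L\<in>layerings \<C> (Suc d) U. weight \<Omega> L)
      = (\<Sum>I\<in>?S. \<Sum>L\<in>(#) I ` layerings \<C> d (closed_nbhd \<C> I). weight \<Omega> L)"
    unfolding layerings.simps using finS finC
    by (intro sum.UNION_disjoint) (auto simp: finite_layerings)
  also have "\<dots> = (\<Sum>I\<in>?S. (\<Prod>B\<in>I. measure \<Omega> (occ B)) *
      (\<Sum>L\<in>layerings \<C> d (closed_nbhd \<C> I). weight \<Omega> L))"
    by (intro sum.cong refl, subst sum.reindex) (auto simp: weight_def sum_distrib_left)
  also have "\<dots> \<le> (\<Sum>I\<in>?S. (\<Prod>B\<in>I. measure \<Omega> (occ B)) *
      (\<Sum>K\<in>Pow (closed_nbhd \<C> I \<inter> \<C>). mu \<Omega> \<C> K))"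
    by (intro sum_mono mult_left_mono Suc.IH prod_nonneg) auto
  also have "\<dots> = (\<Sum>I\<in>?S. mu \<Omega> \<C> I)"
  proof (rule sum.cong[OF refl])
    fix I assume "I \<in> ?S"
    moreover have "closed_nbhd \<C> I \<inter> \<C> = closed_nbhd \<C> I" by (auto simp: closed_nbhd_def)
    ultimately show "(\<Prod>B\<in>I. measure \<Omega> (occ B)) * (\<Sum>K\<in>Pow (closed_nbhd \<C> I \<inter> \<C>). mu \<Omega> \<C> K) = mu \<Omega> \<C> I"
      using mu_recurrence[OF finC, of I] by auto
  qed
  also have "\<dots> \<le> (\<Sum>I\<in>Pow (U \<inter> \<C>). mu \<Omega> \<C> I)"
    using finC mu_nonneg[OF assms] by (intro sum_mono2) auto
  finally show ?case .
qed

section \<open>Resampling words on a table\<close>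

text \<open>
  In a table \<open>R\<close>, the sequence \<open>R 0 i, R 1 i, \<dots>\<close> lists the values that variable \<open>i\<close> takes one after the
  other; row \<open>0\<close> is the current configuration, and resampling discards the top entries of some columns.
\<close>

definition resample_row :: "nat set \<Rightarrow> (nat \<Rightarrow> 'v config) \<Rightarrow> nat \<Rightarrow> 'v config" where
  "resample_row V R = (\<lambda>k i. if i \<in> V then R (Suc k) i else R k i)"

lemma resample_row_commute:
  "resample_row V (resample_row W R) = resample_row W (resample_row V R)"
  by (auto simp: resample_row_def fun_eq_iff)

lemma resample_row_Un:
  "V \<inter> W = {} \<Longrightarrow> resample_row (V \<union> W) R = resample_row W (resample_row V R)"
  by (auto simp: resample_row_def fun_eq_iff)

lemma resample_row_empty [simp]: "resample_row {} R = R"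
  by (simp add: resample_row_def)

definition local_to :: "'v config set \<Rightarrow> nat set \<Rightarrow> 'v config set \<Rightarrow> bool" where
  "local_to X V A \<longleftrightarrow> (\<forall>x\<in>X. \<forall>y\<in>X. (\<forall>i\<in>V. x i = y i) \<longrightarrow> (x \<in> A \<longleftrightarrow> y \<in> A))"

lemma local_toD:
  assumes "local_to X V A" "x \<in> X" "y \<in> X" "\<And>i. i \<in> V \<Longrightarrow> x i = y i"
  shows "x \<in> A \<longleftrightarrow> y \<in> A"
  using assms unfolding local_to_def by blast

fun legal :: "'v config set \<Rightarrow> (nat \<Rightarrow> 'v config) \<Rightarrow> 'v event list \<Rightarrow> bool" where
  "legal D R [] \<longleftrightarrow> R 0 \<in> D"
| "legal D R (B # w) \<longleftrightarrow> R 0 \<in> occ B \<and> legal D (resample_row (var B) R) w"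

text \<open>Here the layers come in the order of resampling, opposite to \<open>layerings\<close>;
  hence the \<open>rev\<close> wherever the two meet.\<close>

fun layer_legal :: "'v config set \<Rightarrow> (nat \<Rightarrow> 'v config) \<Rightarrow> 'v event set list \<Rightarrow> bool" where
  "layer_legal D R [] \<longleftrightarrow> R 0 \<in> D"
| "layer_legal D R (I # K) \<longleftrightarrow>
    (\<forall>B\<in>I. R 0 \<in> occ B) \<and> layer_legal D (resample_row (\<Union>B\<in>I. var B) R) K"

text \<open>A fixed word leads a fixed table to one definite configuration, so unions and, in
  \<open>legal_Diff\<close>, differences of targets pass through \<open>legal\<close>.\<close>

lemma legal_UN: "legal (\<Union>j\<in>J. D j) R w \<longleftrightarrow> (\<exists>j\<in>J. legal (D j) R w)"
  by (induction w arbitrary: R) auto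

lemma legal_Diff: "legal (D - D') R w \<longleftrightarrow> legal D R w \<and> \<not> legal D' R w"
  by (induction w arbitrary: R) auto

text \<open>The setting of the deterministic part of the argument. \<open>mix\<close> holds in every
  product space and keeps the rows of a resampled table inside \<open>X\<close>.\<close>

locale config_space =
  fixes X :: "'v config set" and \<C> :: "'v event set"
  assumes mix: "x \<in> X \<Longrightarrow> y \<in> X \<Longrightarrow> (\<lambda>i. if i \<in> V then x i else y i) \<in> X"
    and bad_local: "B \<in> \<C> \<Longrightarrow> local_to X (var B) (occ B)"
begin

lemma resample_row_in: "(\<And>k. R k \<in> X) \<Longrightarrow> resample_row V R k \<in> X"
  unfolding resample_row_def by (rule mix)

lemma occ_resample_row:
  assumes "\<And>k. R k \<in> X" "B \<in> \<C>" "var B \<inter> V = {}"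
  shows "resample_row V R 0 \<in> occ B \<longleftrightarrow> R 0 \<in> occ B"
  using assms(3)
  by (intro local_toD[OF bad_local[OF assms(2)] resample_row_in[OF assms(1)] assms(1)])
    (auto simp: resample_row_def)

lemma legal_resample_row:
  assumes "\<And>k. R k \<in> X" "set w \<subseteq> \<C>" "\<forall>B\<in>set w. var B \<inter> V = {}" "local_to X W D" "W \<inter> V = {}"
  shows "legal D (resample_row V R) w \<longleftrightarrow> legal D R w"
  using assms
proof (induction w arbitrary: R)
  case Nil
  have "resample_row V R 0 \<in> D \<longleftrightarrow> R 0 \<in> D"
    using Nil.prems(5) by (intro local_toD[OF Nil.prems(4) resample_row_in[OF Nil.prems(1)] Nil.prems(1)])
      (auto simp: resample_row_def)
  thus ?case by simp
next
  case (Cons B w)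
  have "resample_row V R 0 \<in> occ B \<longleftrightarrow> R 0 \<in> occ B"
    using Cons.prems by (intro occ_resample_row) auto
  moreover have "legal D (resample_row V (resample_row (var B) R)) w
      \<longleftrightarrow> legal D (resample_row (var B) R) w"
    using Cons.prems by (intro Cons.IH resample_row_in) auto
  ultimately show ?case by (simp add: resample_row_commute[of "var B"])
qed

text \<open>Neither a letter after \<open>B\<close> nor the target looks at a column of
  \<open>B\<close>, so the shift of these columns goes unnoticed when it is left out.\<close>

lemma legal_drop:
  assumes "\<And>k. R k \<in> X" "set (u @ B # v) \<subseteq> \<C>" "\<forall>B'\<in>set v. \<not> dep B B'"
    and "local_to X W D" "W \<inter> var B = {}" "legal D R (u @ B # v)"
  shows "legal D R (u @ v)"
  using assms
proof (induction u arbitrary: R)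
  case Nil
  thus ?case using legal_resample_row[of R v "var B" W D] by (auto simp: dep_def)
next
  case (Cons B' u)
  thus ?case using resample_row_in[of R] by auto
qed

section \<open>Arranging linked words in stable layers\<close>

definition linked :: "'v event set \<Rightarrow> 'v event list \<Rightarrow> bool" where
  "linked U w \<longleftrightarrow> (\<forall>u B v. w = u @ B # v \<longrightarrow> B \<in> U \<or> (\<exists>B'\<in>set v. dep B B'))"

lemma linked_ConsD:
  assumes "linked U (B # w)"
  shows "linked U w" "B \<in> U \<or> (\<exists>B'\<in>set w. dep B B')"
  using assms unfolding linked_def by (metis append_Cons, metis append_Nil)

text \<open>The condition behind \<open>layerings\<close> without the prescribed length, as a
  predicate that behaves well when lists are cut and joined (\<open>layered_append\<close>).\<close>

fun layered :: "'v event set \<Rightarrow> 'v event set list \<Rightarrow> bool" where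
  "layered U [] \<longleftrightarrow> True"
| "layered U (I # L) \<longleftrightarrow> I \<subseteq> U \<inter> \<C> \<and> stable I \<and> layered (closed_nbhd \<C> I) L"

lemma layered_mem_layerings: "layered U L \<Longrightarrow> L \<in> layerings \<C> (length L) U"
  by (induction L arbitrary: U) auto

lemma layered_mono: "layered U L \<Longrightarrow> U \<subseteq> U' \<Longrightarrow> layered U' L"
  by (cases L) auto

lemma layered_append:
  "layered U (P @ L) \<longleftrightarrow> layered U P \<and> layered (if P = [] then U else closed_nbhd \<C> (last P)) L"
  by (induction P arbitrary: U) auto

lemma layered_subset: "layered U L \<Longrightarrow> I \<in> set L \<Longrightarrow> I \<subseteq> \<C>"
  by (induction L arbitrary: U) auto

text \<open>The layer above admits \<open>B\<close>, the layer \<open>I\<close> stays stable since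
  \<open>B\<close> touches none of its members, and a larger \<open>I\<close> only leaves more room
  for the layer below.\<close>

lemma layered_insert:
  assumes "layered U (P @ I # K)" "B \<in> (if P = [] then U else closed_nbhd \<C> (last P))"
    and "B \<in> \<C>" "B \<notin> closed_nbhd \<C> I"
  shows "layered U (P @ insert B I # K)"
proof -
  have "closed_nbhd \<C> I \<subseteq> closed_nbhd \<C> (insert B I)" by (auto simp: closed_nbhd_def)
  moreover have "stable (insert B I)" if "stable I"
  proof -
    have "\<not> dep B B'" "\<not> dep B' B" if "B' \<in> I" for B'
      using assms(3,4) that dep_sym[of B B'] by (auto simp: closed_nbhd_def)
    thus ?thesis using \<open>stable I\<close> by (simp add: stable_def)
  qed
  ultimately show ?thesis
    using assms layered_mono unfolding layered_append layered.simps by blast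
qed

text \<open>Since \<open>B\<close> shares no variable with the layers of \<open>K\<close> or with
  \<open>I\<close>, its resampling commutes with theirs and can be postponed until it is done
  together with \<open>I\<close>.\<close>

lemma layer_legal_insert:
  assumes "\<And>k. R k \<in> X" "\<forall>I'\<in>set (I # K). I' \<subseteq> \<C> \<and> B \<notin> closed_nbhd \<C> I'" "B \<in> \<C>"
    and "R 0 \<in> occ B" "layer_legal D (resample_row (var B) R) (K @ I # P)"
  shows "layer_legal D R (K @ insert B I # P)"
  using assms
proof (induction K arbitrary: R)
  case Nil
  have disj: "var B' \<inter> var B = {}" if "B' \<in> I" for B'
    using that Nil.prems(2,3) by (auto simp: closed_nbhd_def dep_def)
  have "R 0 \<in> occ B'" if "B' \<in> I" for B'
    using Nil.prems that disj[OF that] occ_resample_row[of R B' "var B"] by auto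
  moreover have "resample_row (\<Union>B\<in>insert B I. var B) R
      = resample_row (\<Union>B\<in>I. var B) (resample_row (var B) R)"
    using disj by (subst resample_row_Un[symmetric]) auto
  ultimately show ?case using Nil.prems by auto
next
  case (Cons I' K)
  let ?V = "\<Union>B\<in>I'. var B"
  have disj: "var B' \<inter> var B = {}" if "B' \<in> I'" for B'
    using that Cons.prems(2,3) by (auto simp: closed_nbhd_def dep_def)
  have "R 0 \<in> occ B'" if "B' \<in> I'" for B'
    using Cons.prems that disj[OF that] occ_resample_row[of R B' "var B"] by auto
  moreover have "layer_legal D (resample_row ?V R) (K @ insert B I # P)"
  proof (rule Cons.IH)
    show "resample_row ?V R k \<in> X" for k using Cons.prems(1) by (rule resample_row_in)
    show "resample_row ?V R 0 \<in> occ B"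
      using Cons.prems(1,3,4) disj by (subst occ_resample_row) auto
    show "layer_legal D (resample_row (var B) (resample_row ?V R)) (K @ I # P)"
      using Cons.prems(5) by (simp add: resample_row_commute)
  qed (use Cons.prems in auto)
  ultimately show ?case by simp
qed

text \<open>Induction on the word: its tail is layered on the table that the first letter leaves,
  and then this letter is inserted. The clause on \<open>\<Union>(set L)\<close> serves the
  induction, as it locates the layer of a later letter to which the first one is linked.\<close>

lemma layering_of_linked_word:
  assumes "\<And>k. R k \<in> X" "set w \<subseteq> \<C>" "linked U w" "legal D R w"
  shows "\<exists>L. length L = length w \<and> layered U L \<and> \<Union>(set L) = set w \<and> layer_legal D R (rev L)"
  using assms
proof (induction w arbitrary: R)
  case Nil
  thus ?case by (intro exI[of _ "[]"]) auto
next
  case (Cons B w)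
  let ?R = "resample_row (var B) R"
  have "B \<in> \<C>" and B: "R 0 \<in> occ B" using Cons.prems by auto
  obtain L where L: "length L = length w" "layered U L" "\<Union>(set L) = set w" "layer_legal D ?R (rev L)"
    using Cons.IH[of ?R] Cons.prems linked_ConsD(1)[of U B w] resample_row_in by auto
  have link: "B \<in> U \<or> (\<exists>I\<in>set L. B \<in> closed_nbhd \<C> I)"
    using linked_ConsD(2)[OF Cons.prems(3)] \<open>B \<in> \<C>\<close> L(3) by (auto simp: closed_nbhd_def)
  \<comment> \<open>The empty bottom layer tests and resamples nothing. It provides a place for
    \<open>B\<close> even if \<open>B\<close> has to open a new layer, and it makes the length grow
    by exactly one.\<close>
  have lay: "layered U (L @ [{}])" by (simp add: layered_append L stable_def)
  \<comment> \<open>\<open>B\<close> is resampled first, so it goes directly below the lowest layer that it touches.\<close>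
  obtain P I K where PIK: "L @ [{}] = P @ I # K"
    "\<forall>I'\<in>set (I # K). B \<notin> closed_nbhd \<C> I'" "B \<in> (if P = [] then U else closed_nbhd \<C> (last P))"
  proof (cases "\<exists>I\<in>set L. B \<in> closed_nbhd \<C> I")
    case True
    then obtain P I Q where Q: "L = P @ I # Q" "B \<in> closed_nbhd \<C> I"
      "\<forall>I'\<in>set Q. B \<notin> closed_nbhd \<C> I'" using split_list_last_prop[OF True] by auto
    obtain I' K where IK: "Q @ [{}] = I' # K" by (cases Q) auto
    have "set (Q @ [{}]) = set (I' # K)" by (simp only: IK)
    hence "\<forall>J\<in>set (I' # K). B \<notin> closed_nbhd \<C> J" using Q(3) by (auto simp: closed_nbhd_def)
    thus ?thesis using that[of "P @ [I]" I' K] Q IK by auto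
  next
    case False
    \<comment> \<open>As \<open>B\<close> touches no layer, \<open>link\<close> leaves only
      \<open>B \<in> U\<close>, and \<open>B\<close> joins the topmost layer.\<close>
    obtain I' K where IK: "L @ [{}] = I' # K" by (cases L) auto
    have "set (L @ [{}]) = set (I' # K)" by (simp only: IK)
    hence "\<forall>J\<in>set (I' # K). B \<notin> closed_nbhd \<C> J" using False by (auto simp: closed_nbhd_def)
    thus ?thesis using that[of "[]" I' K] False link IK by auto
  qed
  have revL: "rev K @ I # rev P = {} # rev L"
    using arg_cong[OF PIK(1), of rev] by simp
  have "layered U (P @ insert B I # K)"
    using lay PIK \<open>B \<in> \<C>\<close> by (intro layered_insert) auto
  moreover have "layer_legal D R (rev K @ insert B I # rev P)"
  proof (rule layer_legal_insert)
    show "\<forall>I'\<in>set (I # rev K). I' \<subseteq> \<C> \<and> B \<notin> closed_nbhd \<C> I'"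
      using PIK(2) layered_subset[OF lay] unfolding PIK(1) by auto
    show "layer_legal D (resample_row (var B) R) (rev K @ I # rev P)"
      unfolding revL using L(4) by simp
  qed (use Cons.prems \<open>B \<in> \<C>\<close> in auto)
  moreover have "length (P @ insert B I # K) = length (B # w)"
    using arg_cong[OF PIK(1), of length] L(1) by simp
  moreover have "\<Union>(set (P @ insert B I # K)) = set (B # w)"
    using arg_cong[OF PIK(1), of "\<lambda>L. \<Union>(set L)"] L(3) by auto
  ultimately show ?case by (intro exI[of _ "P @ insert B I # K"]) auto
qed

text \<open>Empty bottom layers bring all layerings to a common length \<open>d\<close>, so that the
  finite set \<open>layerings \<C> d U\<close> serves all words of length at most
  \<open>d\<close>.\<close>

lemma layered_pad: "layered U L \<Longrightarrow> layered U (L @ replicate k {})"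
proof (induction k)
  case (Suc k)
  have "replicate (Suc k) {} = replicate k {} @ [{} :: 'v event set]" by (simp add: replicate_append_same)
  thus ?case using Suc by (simp only: append_assoc[symmetric] layered_append[of U "L @ replicate k {}"])
    (auto simp: stable_def)
qed simp

lemma layer_legal_pad: "layer_legal D R (replicate k {} @ K) \<longleftrightarrow> layer_legal D R K"
  by (induction k) auto

text \<open>Leastness of \<open>j\<close> excludes the earlier targets for the chosen word itself,
  because a word ending in \<open>D i\<close> with \<open>i < j\<close> would be
  \<open>ok i\<close>. Among the words that are \<open>ok j\<close>, a shortest one is linked by
  \<open>legal_drop\<close>.\<close>

lemma layering_of_legal_word:
  fixes D :: "nat \<Rightarrow> 'v config set"
  assumes R: "\<And>k. R k \<in> X"
    and D: "\<And>j. j \<in> {1..m} \<Longrightarrow> local_to X (W j) (D j)"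
    and w: "set w \<subseteq> \<C>" "length w \<le> d" "legal (\<Union>j\<in>{1..m}. D j) R w"
  shows "\<exists>j\<in>{1..m}. \<exists>L\<in>layerings \<C> d {B\<in>\<C>. var B \<inter> W j \<noteq> {}}.
    layer_legal (D j - (\<Union>i\<in>{1..<j}. D i)) R (rev L)"
proof -
  define ok where "ok j v \<longleftrightarrow> j \<in> {1..m} \<and> set v \<subseteq> \<C> \<and> length v \<le> d \<and> legal (D j) R v" for j v
  have ex: "\<exists>j v. ok j v" using w unfolding legal_UN ok_def by blast
  define j where "j = (LEAST j. \<exists>v. ok j v)"
  have j: "\<exists>v. ok j v" unfolding j_def using ex by (rule LeastI_ex)
  have jmin: "\<not> ok i v" if "i < j" for i v
    using that not_less_Least unfolding j_def by blast
  obtain v where v: "ok j v" and vmin: "\<And>v'. ok j v' \<Longrightarrow> length v \<le> length v'"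
    using ex_has_least_nat[of "ok j" _ length] j by metis
  have jm: "j \<in> {1..m}" and v': "set v \<subseteq> \<C>" "length v \<le> d" "legal (D j) R v"
    using v by (auto simp: ok_def)
  let ?U = "{B\<in>\<C>. var B \<inter> W j \<noteq> {}}" and ?D = "D j - (\<Union>i\<in>{1..<j}. D i)"
  have "linked ?U v"
    unfolding linked_def
  proof (intro allI impI, rule ccontr)
    fix u B x assume vx: "v = u @ B # x" and "\<not> (B \<in> ?U \<or> (\<exists>B'\<in>set x. dep B B'))"
    hence "B \<in> \<C>" "W j \<inter> var B = {}" "\<forall>B'\<in>set x. \<not> dep B B'" using v'(1) by auto
    hence "legal (D j) R (u @ x)"
      by (intro legal_drop[OF R v'(1)[unfolded vx] _ D[OF jm] _ v'(3)[unfolded vx]])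
    hence "ok j (u @ x)" using v' jm vx by (auto simp: ok_def)
    from vmin[OF this] show False using vx by simp
  qed
  moreover have "legal ?D R v"
  proof -
    have "\<not> legal (D i) R v" if "i \<in> {1..<j}" for i
      using jmin[of i v] that v jm by (auto simp: ok_def)
    thus ?thesis using v'(3) by (simp add: legal_Diff legal_UN)
  qed
  ultimately obtain L where L: "length L = length v" "layered ?U L" "layer_legal ?D R (rev L)"
    using layering_of_linked_word[of R v ?U ?D] R v'(1) by blast
  let ?L = "L @ replicate (d - length L) {}"
  have "?L \<in> layerings \<C> d ?U"
    using layered_mem_layerings[OF layered_pad[OF L(2)], of "d - length L"] L(1) v'(2) by simp
  moreover have "layer_legal ?D R (rev ?L)" using L(3) by (simp add: layer_legal_pad)
  ultimately show ?thesis using jm by blast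
qed

text \<open>Existence of a legal word of length at most \<open>d\<close>, unfolded by its first
  letter: this form suits measurability and the comparison with a single step of the
  algorithm.\<close>

fun reaches :: "'v config set \<Rightarrow> nat \<Rightarrow> (nat \<Rightarrow> 'v config) \<Rightarrow> bool" where
  "reaches E 0 R \<longleftrightarrow> R 0 \<in> E"
| "reaches E (Suc d) R \<longleftrightarrow> R 0 \<in> E \<or> (\<exists>B\<in>\<C>. R 0 \<in> occ B \<and> reaches E d (resample_row (var B) R))"

lemma reaches_now: "R 0 \<in> E \<Longrightarrow> reaches E d R"
  by (cases d) auto

lemma reaches_Suc: "reaches E d R \<Longrightarrow> reaches E (Suc d) R"
  by (induction d arbitrary: R) auto

lemma reaches_word: "reaches E d R \<Longrightarrow> \<exists>w. set w \<subseteq> \<C> \<and> length w \<le> d \<and> legal E R w"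
proof (induction d arbitrary: R)
  case 0
  thus ?case by (intro exI[of _ "[]"]) auto
next
  case (Suc d)
  show ?case
  proof (cases "R 0 \<in> E")
    case True
    thus ?thesis by (intro exI[of _ "[]"]) auto
  next
    case False
    then obtain B where B: "B \<in> \<C>" "R 0 \<in> occ B" "reaches E d (resample_row (var B) R)"
      using Suc.prems by auto
    from Suc.IH[OF B(3)] obtain w where "set w \<subseteq> \<C>" "length w \<le> d"
      "legal E (resample_row (var B) R) w" by blast
    thus ?thesis using B by (intro exI[of _ "B # w"]) auto
  qed
qed

end

section \<open>Random tables\<close>

lemma measurable_override_on [measurable (raw)]:
  assumes f: "f \<in> measurable N (PiM I M)" and g: "g \<in> measurable N (PiM I M)"
  shows "(\<lambda>\<omega>. override_on (f \<omega>) (g \<omega>) V) \<in> measurable N (PiM I M)"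
  unfolding override_on_def
proof (rule measurable_PiM_single')
  fix i assume "i \<in> I"
  thus "(\<lambda>\<omega>. if i \<in> V then g \<omega> i else f \<omega> i) \<in> measurable N (M i)"
    using measurable_compose[OF f measurable_component_singleton[of i I M]]
      measurable_compose[OF g measurable_component_singleton[of i I M]] by auto
next
  have "f \<omega> \<in> space (PiM I M)" "g \<omega> \<in> space (PiM I M)" if "\<omega> \<in> space N" for \<omega>
    using that f g by (auto dest: measurable_space)
  thus "(\<lambda>\<omega> i. if i \<in> V then g \<omega> i else f \<omega> i) \<in> space N \<rightarrow> (\<Pi>\<^sub>E i\<in>I. space (M i))"
    by (fastforce simp: space_PiM PiE_iff extensional_def)
qed

locale variable_space = finite_product_prob_space M I
  for M :: "nat \<Rightarrow> 'v measure" and I :: "nat set"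
begin

abbreviation "\<Omega> \<equiv> PiM I M"
abbreviation "Y \<equiv> \<Pi>\<^sub>M k\<in>(UNIV::nat set). \<Omega>"

sublocale table: sequence_space \<Omega> ..

text \<open>Checked on boxes: the preimage of a box is a product of two boxes, and for each variable
  one of the two sides is the whole space, of measure 1.\<close>

lemma distr_override_on:
  "distr (\<Omega> \<Otimes>\<^sub>M \<Omega>) \<Omega> (\<lambda>(x, y). override_on y x V) = \<Omega>"
proof (rule PiM_eqI)
  fix A assume A: "\<And>i. i \<in> I \<Longrightarrow> A i \<in> sets (M i)"
  let ?A1 = "\<lambda>i. if i \<in> V then A i else space (M i)" and ?A2 = "\<lambda>i. if i \<in> V then space (M i) else A i"
  have [measurable]: "PiE I A \<in> sets \<Omega>" using A by (intro sets_PiM_I_finite finite_index)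
  have eq: "(\<lambda>(x, y). override_on y x V) -` PiE I A \<inter> space (\<Omega> \<Otimes>\<^sub>M \<Omega>) = PiE I ?A1 \<times> PiE I ?A2"
  proof (rule set_eqI, clarify)
    fix x y :: "nat \<Rightarrow> 'v"
    have "A i \<subseteq> space (M i)" if "i \<in> I" for i using A[OF that] sets.sets_into_space by auto
    thus "(x, y) \<in> (\<lambda>(x, y). override_on y x V) -` PiE I A \<inter> space (\<Omega> \<Otimes>\<^sub>M \<Omega>)
        \<longleftrightarrow> (x, y) \<in> PiE I ?A1 \<times> PiE I ?A2"
      by (fastforce simp: space_pair_measure space_PiM PiE_iff override_on_def extensional_def split: if_splits)
  qed
  have "emeasure (distr (\<Omega> \<Otimes>\<^sub>M \<Omega>) \<Omega> (\<lambda>(x, y). override_on y x V)) (PiE I A)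
      = emeasure \<Omega> (PiE I ?A1) * emeasure \<Omega> (PiE I ?A2)"
    using A by (subst emeasure_distr)
      (auto simp: eq intro!: emeasure_pair_measure_Times sets_PiM_I_finite finite_index)
  also have "\<dots> = (\<Prod>i\<in>I. emeasure (M i) (?A1 i)) * (\<Prod>i\<in>I. emeasure (M i) (?A2 i))"
    using A finite_index by (simp add: emeasure_PiM)
  also have "\<dots> = (\<Prod>i\<in>I. emeasure (M i) (A i))"
    unfolding prod.distrib[symmetric] by (intro prod.cong) (auto simp: M.emeasure_space_1)
  finally show "emeasure (distr (\<Omega> \<Otimes>\<^sub>M \<Omega>) \<Omega> (\<lambda>(x, y). override_on y x V)) (PiE I A)
      = (\<Prod>i\<in>I. emeasure (M i) (A i))" .
qed (auto simp: finite_index)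

lemma nn_integral_prod_components:
  assumes "finite J" and f: "\<And>j. j \<in> J \<Longrightarrow> f j \<in> borel_measurable \<Omega>"
  shows "(\<integral>\<^sup>+a. (\<Prod>j\<in>J. f j (a j)) \<partial>Y) = (\<Prod>j\<in>J. \<integral>\<^sup>+x. f j x \<partial>\<Omega>)"
proof -
  have m: "(\<lambda>a. \<Prod>j\<in>J. f j (a j)) \<in> borel_measurable (PiM J (\<lambda>_. \<Omega>))"
    using f by (intro borel_measurable_prod_ennreal measurable_compose[OF measurable_component_singleton])
  have "(\<integral>\<^sup>+a. (\<Prod>j\<in>J. f j (a j)) \<partial>Y) = (\<integral>\<^sup>+a. (\<Prod>j\<in>J. f j (restrict a J j)) \<partial>Y)"
    by (intro nn_integral_cong prod.cong) auto
  also have "\<dots> = (\<integral>\<^sup>+a. (\<Prod>j\<in>J. f j (a j)) \<partial>distr Y (PiM J (\<lambda>_. \<Omega>)) (\<lambda>a. restrict a J))"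
    using m by (intro nn_integral_distr[symmetric] measurable_restrict_subset) auto
  also have "\<dots> = (\<Prod>j\<in>J. \<integral>\<^sup>+x. f j x \<partial>\<Omega>)"
    using table.distr_PiM_restrict_finite[OF assms(1)] table.product_nn_integral_prod[of J f] assms by simp
  finally show ?thesis .
qed

lemma space_table: "R \<in> space Y \<longleftrightarrow> (\<forall>k. R k \<in> space \<Omega>)"
  by (subst space_PiM) (auto simp: PiE_iff)

lemma measurable_rows:
  assumes "\<And>k. (\<lambda>\<omega>. f \<omega> k) \<in> measurable N \<Omega>"
  shows "(\<lambda>\<omega> k. f \<omega> k) \<in> measurable N Y"
proof (rule measurable_PiM_single')
  show "(\<lambda>\<omega> k. f \<omega> k) \<in> space N \<rightarrow> (\<Pi>\<^sub>E k\<in>UNIV. space \<Omega>)"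
    by (intro funcsetI PiE_I measurable_space[OF assms]) auto
qed (rule assms)

lemma measurable_shift_rows:
  assumes "f \<in> measurable N Y"
  shows "(\<lambda>\<omega> k. f \<omega> (c k)) \<in> measurable N Y"
  by (rule measurable_rows) (use assms in measurable)

lemma measurable_columns:
  assumes f: "f \<in> measurable N Y" and g: "g \<in> measurable N Y"
  shows "(\<lambda>\<omega> k. override_on (f \<omega> k) (g \<omega> k) V) \<in> measurable N Y"
  by (rule measurable_rows) (use f g in measurable)

text \<open>The analogue of \<open>distr_override_on\<close> for tables. On a cylinder set, Fubini
  and the independence of the rows reduce the claim to one factor per row, which
  \<open>distr_override_on\<close> evaluates.\<close>

lemma distr_columns:
  "distr (Y \<Otimes>\<^sub>M Y) Y (\<lambda>(a, b) k. override_on (b k) (a k) V) = Y"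
proof (rule table.PiM_eq)
  fix J :: "nat set" and F assume J: "finite J" and F: "\<And>j. j \<in> J \<Longrightarrow> F j \<in> sets \<Omega>"
  define mix where "mix = (\<lambda>(a, b) (k::nat). override_on (b k) (a k :: nat \<Rightarrow> 'v) V)"
  have mix [measurable]: "mix \<in> measurable (Y \<Otimes>\<^sub>M Y) Y"
    unfolding mix_def case_prod_beta by (rule measurable_columns) measurable
  let ?E = "prod_emb UNIV (\<lambda>_. \<Omega>) J (PiE J F)"
  have E: "?E = {a\<in>space Y. \<forall>j\<in>J. a j \<in> F j}"
    by (subst space_PiM) (auto simp: prod_emb_def PiE_iff)
  have [measurable]: "?E \<in> sets Y" using J F by (intro sets_PiM_I) auto
  have G: "{x\<in>space \<Omega>. override_on x y V \<in> F j} \<in> sets \<Omega>" if "y \<in> space \<Omega>" "j \<in> J" for y j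
  proof -
    have [measurable]: "(\<lambda>x. y) \<in> measurable \<Omega> \<Omega>" "F j \<in> sets \<Omega>" using that F by auto
    show ?thesis by measurable
  qed
  have H: "(\<lambda>(y, x). override_on x y V) -` F j \<inter> space (\<Omega> \<Otimes>\<^sub>M \<Omega>) \<in> sets (\<Omega> \<Otimes>\<^sub>M \<Omega>)" if "j \<in> J" for j
    using F[OF that] by (intro measurable_sets[where A=\<Omega>]) measurable
  have sec: "Pair y -` ((\<lambda>(y, x). override_on x y V) -` F j \<inter> space (\<Omega> \<Otimes>\<^sub>M \<Omega>))
      = {x\<in>space \<Omega>. override_on x y V \<in> F j}" if "y \<in> space \<Omega>" for y j
    using that by (auto simp: space_pair_measure)
  have meas: "(\<lambda>y. emeasure \<Omega> {x\<in>space \<Omega>. override_on x y V \<in> F j}) \<in> borel_measurable \<Omega>" if "j \<in> J" for j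
    using measurable_emeasure_Pair[OF H[OF that]]
    by (rule measurable_cong[THEN iffD1, rotated]) (simp only: sec)
  have "emeasure (distr (Y \<Otimes>\<^sub>M Y) Y mix) ?E = emeasure (Y \<Otimes>\<^sub>M Y) (mix -` ?E \<inter> space (Y \<Otimes>\<^sub>M Y))"
    by (rule emeasure_distr) measurable
  also have "\<dots> = (\<integral>\<^sup>+a. emeasure Y (Pair a -` (mix -` ?E \<inter> space (Y \<Otimes>\<^sub>M Y))) \<partial>Y)"
    by (rule table.P.emeasure_pair_measure_alt) measurable
  also have "\<dots> = (\<integral>\<^sup>+a. (\<Prod>j\<in>J. emeasure \<Omega> {x\<in>space \<Omega>. override_on x (a j) V \<in> F j}) \<partial>Y)"
  proof (rule nn_integral_cong)
    fix a assume a: "a \<in> space Y"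
    hence aj: "a j \<in> space \<Omega>" for j by (simp add: space_table)
    have "Pair a -` (mix -` ?E \<inter> space (Y \<Otimes>\<^sub>M Y))
        = {b\<in>space Y. \<forall>j\<in>J. b j \<in> {x\<in>space \<Omega>. override_on x (a j) V \<in> F j}}"
    proof (rule set_eqI)
      fix b
      have "mix (a, b) \<in> space Y" if "b \<in> space Y"
        using that a by (intro measurable_space[OF mix]) (simp add: space_pair_measure)
      thus "b \<in> Pair a -` (mix -` ?E \<inter> space (Y \<Otimes>\<^sub>M Y)) \<longleftrightarrow>
          b \<in> {b\<in>space Y. \<forall>j\<in>J. b j \<in> {x\<in>space \<Omega>. override_on x (a j) V \<in> F j}}"
        using a unfolding E by (auto simp: space_pair_measure mix_def space_table)
    qed
    thus "emeasure Y (Pair a -` (mix -` ?E \<inter> space (Y \<Otimes>\<^sub>M Y)))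
        = (\<Prod>j\<in>J. emeasure \<Omega> {x\<in>space \<Omega>. override_on x (a j) V \<in> F j})"
      using table.emeasure_PiM_Collect[of J "\<lambda>j. {x\<in>space \<Omega>. override_on x (a j) V \<in> F j}"] J G aj by simp
  qed
  also have "\<dots> = (\<Prod>j\<in>J. \<integral>\<^sup>+y. emeasure \<Omega> {x\<in>space \<Omega>. override_on x y V \<in> F j} \<partial>\<Omega>)"
    by (rule nn_integral_prod_components[OF J meas])
  also have "\<dots> = (\<Prod>j\<in>J. emeasure \<Omega> (F j))"
  proof (rule prod.cong[OF refl])
    fix j assume j: "j \<in> J"
    have "emeasure \<Omega> (F j) = emeasure (distr (\<Omega> \<Otimes>\<^sub>M \<Omega>) \<Omega> (\<lambda>(y, x). override_on x y V)) (F j)"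
      by (simp only: distr_override_on)
    also have "\<dots> = emeasure (\<Omega> \<Otimes>\<^sub>M \<Omega>) ((\<lambda>(y, x). override_on x y V) -` F j \<inter> space (\<Omega> \<Otimes>\<^sub>M \<Omega>))"
      using F[OF j] by (intro emeasure_distr) measurable
    also have "\<dots> = (\<integral>\<^sup>+y. emeasure \<Omega> (Pair y -` ((\<lambda>(y, x). override_on x y V) -` F j \<inter> space (\<Omega> \<Otimes>\<^sub>M \<Omega>))) \<partial>\<Omega>)"
      by (rule emeasure_pair_measure_alt[OF H[OF j]])
    also have "\<dots> = (\<integral>\<^sup>+y. emeasure \<Omega> {x\<in>space \<Omega>. override_on x y V \<in> F j} \<partial>\<Omega>)"
      by (rule nn_integral_cong) (simp only: sec)
    finally show "(\<integral>\<^sup>+y. emeasure \<Omega> {x\<in>space \<Omega>. override_on x y V \<in> F j} \<partial>\<Omega>) = emeasure \<Omega> (F j)" by simp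
  qed
  finally show "emeasure (distr (Y \<Otimes>\<^sub>M Y) Y (\<lambda>(a, b) k. override_on (b k) (a k) V)) ?E
      = (\<Prod>j\<in>J. emeasure \<Omega> (F j))" unfolding mix_def .
qed simp

text \<open>Here \<open>w\<close> is the table left after resampling \<open>V\<close>, and \<open>u\<close> holds the discarded entries.\<close>

definition graft :: "nat set \<Rightarrow> 'v config \<Rightarrow> (nat \<Rightarrow> 'v config) \<Rightarrow> nat \<Rightarrow> 'v config" where
  "graft V u w = (\<lambda>k. override_on (w k) (case_nat u w k) V)"

lemma measurable_graft [measurable (raw)]:
  assumes f: "f \<in> measurable N \<Omega>" and g: "g \<in> measurable N Y"
  shows "(\<lambda>\<omega>. graft V (f \<omega>) (g \<omega>)) \<in> measurable N Y"
  unfolding graft_def by (rule measurable_columns[OF g measurable_case_nat'[OF f g]])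

section \<open>Fresh entries on top of a random table\<close>

lemma nn_integral_case_nat:
  assumes [measurable]: "f \<in> borel_measurable Y"
  shows "(\<integral>\<^sup>+u. \<integral>\<^sup>+w. f (case_nat u w) \<partial>Y \<partial>\<Omega>) = (\<integral>\<^sup>+w. f w \<partial>Y)"
proof -
  have "(\<integral>\<^sup>+w. f w \<partial>Y) = (\<integral>\<^sup>+w. f w \<partial>distr (\<Omega> \<Otimes>\<^sub>M Y) Y (\<lambda>(u, w). case_nat u w))"
    by (simp only: table.PiM_iter)
  also have "\<dots> = (\<integral>\<^sup>+p. f ((\<lambda>(u, w). case_nat u w) p) \<partial>(\<Omega> \<Otimes>\<^sub>M Y))"
    by (rule nn_integral_distr) measurable
  also have "\<dots> = (\<integral>\<^sup>+u. \<integral>\<^sup>+w. f (case_nat u w) \<partial>Y \<partial>\<Omega>)"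
    by (subst table.P.nn_integral_fst[symmetric]) auto
  finally show ?thesis by simp
qed

text \<open>By \<open>distr_columns\<close>, \<open>w\<close> may be composed of independent tables,
  \<open>a\<close> in the columns of \<open>V\<close> and \<open>b\<close> elsewhere. Grafting
  replaces \<open>a\<close> by \<open>case_nat u a\<close>, which is again distributed like a table
  and independent of \<open>b\<close>.\<close>

lemma nn_integral_graft:
  assumes [measurable]: "f \<in> borel_measurable Y"
  shows "(\<integral>\<^sup>+u. \<integral>\<^sup>+w. f (graft V u w) \<partial>Y \<partial>\<Omega>) = (\<integral>\<^sup>+w. f w \<partial>Y)"
proof -
  let ?mix = "\<lambda>(a, b) k. override_on (b k) (a k :: nat \<Rightarrow> 'v) V"
  have [measurable]: "?mix \<in> measurable (Y \<Otimes>\<^sub>M Y) Y"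
    unfolding case_prod_beta by (rule measurable_columns) measurable
  have mix: "(\<integral>\<^sup>+w. g w \<partial>Y) = (\<integral>\<^sup>+a. \<integral>\<^sup>+b. g (?mix (a, b)) \<partial>Y \<partial>Y)"
    if [measurable]: "g \<in> borel_measurable Y" for g
  proof -
    have "(\<integral>\<^sup>+w. g w \<partial>Y) = (\<integral>\<^sup>+w. g w \<partial>distr (Y \<Otimes>\<^sub>M Y) Y ?mix)"
      by (simp only: distr_columns)
    also have "\<dots> = (\<integral>\<^sup>+p. g (?mix p) \<partial>(Y \<Otimes>\<^sub>M Y))"
      by (rule nn_integral_distr) measurable
    also have "\<dots> = (\<integral>\<^sup>+a. \<integral>\<^sup>+b. g (?mix (a, b)) \<partial>Y \<partial>Y)"
      by (subst table.P.nn_integral_fst[symmetric]) auto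
    finally show ?thesis .
  qed
  have gm: "graft V u (\<lambda>k. override_on (b k) (a k) V) = (\<lambda>k. override_on (b k) (case_nat u a k) V)" for u a b
    by (auto simp: graft_def override_on_def fun_eq_iff split: nat.split)
  have "(\<integral>\<^sup>+u. \<integral>\<^sup>+w. f (graft V u w) \<partial>Y \<partial>\<Omega>)
      = (\<integral>\<^sup>+u. \<integral>\<^sup>+a. \<integral>\<^sup>+b. f (?mix (case_nat u a, b)) \<partial>Y \<partial>Y \<partial>\<Omega>)"
  proof (rule nn_integral_cong)
    fix u assume "u \<in> space \<Omega>"
    hence [measurable]: "(\<lambda>_. u) \<in> measurable Y \<Omega>" by simp
    show "(\<integral>\<^sup>+w. f (graft V u w) \<partial>Y) = (\<integral>\<^sup>+a. \<integral>\<^sup>+b. f (?mix (case_nat u a, b)) \<partial>Y \<partial>Y)"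
      by (subst mix) (measurable, simp add: gm)
  qed
  also have "\<dots> = (\<integral>\<^sup>+a. \<integral>\<^sup>+b. f (?mix (a, b)) \<partial>Y \<partial>Y)"
    by (rule nn_integral_case_nat) measurable
  also have "\<dots> = (\<integral>\<^sup>+w. f w \<partial>Y)" by (rule mix[symmetric]) measurable
  finally show ?thesis .
qed

lemma measurable_resample_row [measurable (raw)]:
  assumes f: "f \<in> measurable N Y"
  shows "(\<lambda>\<omega>. resample_row V (f \<omega>)) \<in> measurable N Y"
proof -
  have eq: "resample_row V R = (\<lambda>k. override_on (R k) (R (Suc k)) V)" for R :: "nat \<Rightarrow> 'v config"
    by (auto simp: resample_row_def override_on_def)
  show ?thesis unfolding eq by (rule measurable_columns[OF f measurable_shift_rows[OF f]])
qed

lemma resample_row_graft: "resample_row V (graft V u w) = w"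
  by (auto simp: resample_row_def graft_def override_on_def fun_eq_iff)

text \<open>Write the table as \<open>graft V u w\<close>: the event \<open>B\<close> sees only
  \<open>u\<close>, and resampling returns \<open>w\<close>, so the integral factors. Thus the table
  left by a resampling is fresh and independent of the discarded entries.\<close>

lemma emeasure_resample:
  assumes B: "B \<in> sets \<Omega>" "local_to (space \<Omega>) V B" and T: "T \<in> sets Y"
  shows "emeasure Y {R\<in>space Y. R 0 \<in> B \<and> resample_row V R \<in> T} = emeasure \<Omega> B * emeasure Y T"
proof -
  note [measurable] = B(1) T
  let ?E = "{R\<in>space Y. R 0 \<in> B \<and> resample_row V R \<in> T}"
  have [measurable]: "?E \<in> sets Y" by measurable
  have ind: "indicator ?E (graft V u w) = (indicator B u * indicator T w :: ennreal)"
    if uw: "u \<in> space \<Omega>" "w \<in> space Y" for u w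
  proof -
    have g: "graft V u w \<in> space Y"
      using measurable_graft[OF measurable_const[OF uw(1)] measurable_ident, THEN measurable_space] uw(2)
      by auto
    hence "graft V u w 0 \<in> space \<Omega>" by (simp add: space_table)
    hence "graft V u w 0 \<in> B \<longleftrightarrow> u \<in> B"
      using uw(1) by (intro local_toD[OF B(2)]) (auto simp: graft_def)
    thus ?thesis using g by (auto simp: indicator_def resample_row_graft)
  qed
  have "emeasure Y ?E = (\<integral>\<^sup>+u. \<integral>\<^sup>+w. indicator ?E (graft V u w) \<partial>Y \<partial>\<Omega>)"
    by (subst nn_integral_graft) auto
  also have "\<dots> = (\<integral>\<^sup>+u. \<integral>\<^sup>+w. indicator B u * indicator T w \<partial>Y \<partial>\<Omega>)"
    by (intro nn_integral_cong ind)
  also have "\<dots> = emeasure \<Omega> B * emeasure Y T"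
    by (simp add: nn_integral_cmult nn_integral_multc)
  finally show ?thesis .
qed

text \<open>The algorithm draws a whole row and wastes its entries outside \<open>V\<close>, whereas
  the table keeps them for later use. Substituting \<open>case_nat u w\<close> for the left
  \<open>w\<close> and \<open>graft V u w\<close> for the right one produces the same table on both
  sides.\<close>

lemma emeasure_fresh_row:
  assumes x: "x \<in> space \<Omega>" and T [measurable]: "T \<in> sets Y"
  shows "emeasure Y {w\<in>space Y. case_nat (override_on x (w 0) V) (\<lambda>k. w (Suc k)) \<in> T}
    = emeasure Y {w\<in>space Y. resample_row V (case_nat x w) \<in> T}" (is "emeasure Y ?L = emeasure Y ?R")
proof -
  have [measurable]: "(\<lambda>_. x) \<in> measurable N \<Omega>" for N :: "'b measure" using x by simp
  have [measurable]: "(\<lambda>w k. w (Suc k)) \<in> measurable Y Y"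
    by (rule measurable_shift_rows) measurable
  have [measurable]: "?L \<in> sets Y" "?R \<in> sets Y" by measurable
  have spc: "case_nat u w \<in> space Y" "graft V u w \<in> space Y" if "u \<in> space \<Omega>" "w \<in> space Y" for u w
    using measurable_case_nat'[OF measurable_const[OF that(1)] measurable_ident, THEN measurable_space]
      measurable_graft[OF measurable_const[OF that(1)] measurable_ident, THEN measurable_space] that(2)
    by auto
  have rg: "resample_row V (case_nat x (graft V u w)) = case_nat (override_on x u V) w" for u w
    by (auto simp: resample_row_def graft_def override_on_def fun_eq_iff split: nat.split)
  have "emeasure Y ?L = (\<integral>\<^sup>+u. \<integral>\<^sup>+w. indicator ?L (case_nat u w) \<partial>Y \<partial>\<Omega>)"
    by (subst nn_integral_case_nat) auto
  also have "\<dots> = (\<integral>\<^sup>+u. \<integral>\<^sup>+w. indicator ?R (graft V u w) \<partial>Y \<partial>\<Omega>)"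
    using spc by (intro nn_integral_cong) (simp add: indicator_def rg)
  also have "\<dots> = emeasure Y ?R" by (subst nn_integral_graft) auto
  finally show ?thesis .
qed

end

section \<open>The union bound and the run of the algorithm\<close>

locale resampling_space = variable_space M I
  for M :: "nat \<Rightarrow> 'v measure" and I :: "nat set" +
  fixes \<C> :: "'v event set"
  assumes finite_bad: "finite \<C>"
    and occ_bad [measurable]: "B \<in> \<C> \<Longrightarrow> occ B \<in> sets (PiM I M)"
    and local_bad: "B \<in> \<C> \<Longrightarrow> local_to (space (PiM I M)) (var B) (occ B)"

sublocale resampling_space \<subseteq> config_space "space \<Omega>" \<C>
proof
  fix x y :: "nat \<Rightarrow> 'v" and V
  assume "x \<in> space \<Omega>" "y \<in> space \<Omega>"
  thus "(\<lambda>i. if i \<in> V then x i else y i) \<in> space \<Omega>"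
    by (auto simp: space_PiM PiE_iff extensional_def)
qed (rule local_bad)

context resampling_space
begin

text \<open>The members of a stable set use disjoint columns, so they can be resampled one at a time
  without changing the truth of the others, with \<open>emeasure_resample\<close> giving one factor
  each.\<close>

lemma emeasure_resample_stable:
  assumes "finite J" "J \<subseteq> \<C>" "stable J" "T \<in> sets Y"
  shows "{R\<in>space Y. (\<forall>B\<in>J. R 0 \<in> occ B) \<and> resample_row (\<Union>B\<in>J. var B) R \<in> T} \<in> sets Y \<and>
    emeasure Y {R\<in>space Y. (\<forall>B\<in>J. R 0 \<in> occ B) \<and> resample_row (\<Union>B\<in>J. var B) R \<in> T}
      = (\<Prod>B\<in>J. emeasure \<Omega> (occ B)) * emeasure Y T"
  using assms
proof (induction J)
  case empty
  have "{R \<in> space Y. R \<in> T} = T" using sets.sets_into_space[OF empty(3)] by auto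
  thus ?case using empty by simp
next
  case (insert B J)
  let ?T = "{R\<in>space Y. (\<forall>B\<in>J. R 0 \<in> occ B) \<and> resample_row (\<Union>B\<in>J. var B) R \<in> T}"
  let ?S = "{R\<in>space Y. (\<forall>B\<in>insert B J. R 0 \<in> occ B) \<and> resample_row (\<Union>B\<in>insert B J. var B) R \<in> T}"
  have IH: "?T \<in> sets Y" "emeasure Y ?T = (\<Prod>B\<in>J. emeasure \<Omega> (occ B)) * emeasure Y T"
    using insert stable_subset[of "insert B J" J] by auto
  note [measurable] = IH(1)
  have B [measurable]: "B \<in> \<C>" "occ B \<in> sets \<Omega>" using insert.prems(1) occ_bad by auto
  have disj: "var B' \<inter> var B = {}" if "B' \<in> J" for B'
  proof -
    have "B' \<noteq> B" using that insert.hyps(2) by auto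
    thus ?thesis using insert.prems(2) that by (auto simp: stable_def dep_def)
  qed
  have "?S = {R\<in>space Y. R 0 \<in> occ B \<and> resample_row (var B) R \<in> ?T}"
  proof (rule Collect_cong)
    fix R
    show "(R \<in> space Y \<and> (\<forall>B\<in>insert B J. R 0 \<in> occ B) \<and> resample_row (\<Union>B\<in>insert B J. var B) R \<in> T)
      \<longleftrightarrow> (R \<in> space Y \<and> R 0 \<in> occ B \<and> resample_row (var B) R \<in> ?T)"
    proof (cases "R \<in> space Y")
      case True
      hence R: "\<And>k. R k \<in> space \<Omega>" by (simp add: space_table)
      have "resample_row (var B) R \<in> space Y" using resample_row_in[of R] R by (simp add: space_table)
      moreover have "resample_row (\<Union>B\<in>insert B J. var B) R
          = resample_row (\<Union>B\<in>J. var B) (resample_row (var B) R)"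
        using disj by (subst resample_row_Un[symmetric]) auto
      moreover have "resample_row (var B) R 0 \<in> occ B' \<longleftrightarrow> R 0 \<in> occ B'" if "B' \<in> J" for B'
        using occ_resample_row[of R B' "var B"] R disj[OF that] that insert.prems(1) by auto
      ultimately show ?thesis using True by auto
    qed simp
  qed
  moreover have "{R\<in>space Y. R 0 \<in> occ B \<and> resample_row (var B) R \<in> ?T} \<in> sets Y" by measurable
  moreover have "emeasure Y {R\<in>space Y. R 0 \<in> occ B \<and> resample_row (var B) R \<in> ?T}
      = emeasure \<Omega> (occ B) * emeasure Y ?T"
    using B local_bad IH(1) by (intro emeasure_resample) auto
  ultimately show ?case using IH(2) insert.hyps by (simp add: mult.assoc)
qed

lemma measure_layer_legal:
  assumes "D \<in> sets \<Omega>" "\<forall>J\<in>set K. J \<subseteq> \<C> \<and> stable J"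
  shows "{R\<in>space Y. layer_legal D R K} \<in> sets Y \<and>
    measure Y {R\<in>space Y. layer_legal D R K} = weight \<Omega> K * measure \<Omega> D"
  using assms(2)
proof (induction K)
  case Nil
  note [measurable] = assms(1)
  have "{R\<in>space Y. R 0 \<in> D} \<in> sets Y" by measurable
  moreover have "emeasure Y {R\<in>space Y. R 0 \<in> D} = emeasure \<Omega> D"
    using table.emeasure_PiM_Collect_single[of 0 D] assms(1) by simp
  ultimately show ?case by (simp add: weight_def measure_def)
next
  case (Cons J K)
  let ?T = "{R\<in>space Y. layer_legal D R K}"
  have IH: "?T \<in> sets Y" "measure Y ?T = weight \<Omega> K * measure \<Omega> D" using Cons by auto
  have J: "J \<subseteq> \<C>" "stable J" "finite J" using Cons.prems finite_bad finite_subset by auto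
  have "resample_row V R \<in> space Y" if "R \<in> space Y" for R :: "nat \<Rightarrow> nat \<Rightarrow> 'v" and V
    using that resample_row_in[of R] by (simp add: space_table)
  hence eq: "{R\<in>space Y. layer_legal D R (J # K)}
      = {R\<in>space Y. (\<forall>B\<in>J. R 0 \<in> occ B) \<and> resample_row (\<Union>B\<in>J. var B) R \<in> ?T}" by auto
  have "emeasure Y {R\<in>space Y. layer_legal D R (J # K)}
      = (\<Prod>B\<in>J. emeasure \<Omega> (occ B)) * emeasure Y ?T"
    unfolding eq using emeasure_resample_stable[OF J(3,1,2) IH(1)] by blast
  also have "\<dots> = ennreal ((\<Prod>B\<in>J. measure \<Omega> (occ B)) * measure Y ?T)"
    by (simp add: P.emeasure_eq_measure table.P.emeasure_eq_measure prod_ennreal ennreal_mult' prod_nonneg)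
  finally have "measure Y {R\<in>space Y. layer_legal D R (J # K)}
      = (\<Prod>B\<in>J. measure \<Omega> (occ B)) * measure Y ?T"
    by (intro measure_eq_emeasure_eq_ennreal) (auto intro!: mult_nonneg_nonneg prod_nonneg)
  moreover have "{R\<in>space Y. layer_legal D R (J # K)} \<in> sets Y"
    unfolding eq using emeasure_resample_stable[OF J(3,1,2) IH(1)] by blast
  ultimately show ?case by (simp add: IH(2) weight_def mult.assoc)
qed

lemma layerings_stable: "L \<in> layerings \<C> d U \<Longrightarrow> \<forall>J\<in>set L. J \<subseteq> \<C> \<and> stable J"
proof (induction d arbitrary: U L)
  case (Suc d)
  then obtain J L' where "L = J # L'" "J \<subseteq> \<C>" "stable J" "L' \<in> layerings \<C> d (closed_nbhd \<C> J)"
    by auto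
  thus ?case using Suc.IH by simp
qed simp

lemma weight_rev: "weight \<Omega> (rev L) = weight \<Omega> L"
  by (induction L) (simp_all add: weight_def)

lemma sets_reaches:
  assumes E: "E \<in> sets \<Omega>"
  shows "{R\<in>space Y. reaches E d R} \<in> sets Y"
proof (induction d)
  case 0
  note [measurable] = E
  show ?case by simp measurable
next
  case (Suc d)
  note [measurable] = E Suc
  have "resample_row V R \<in> space Y" if "R \<in> space Y" for R :: "nat \<Rightarrow> nat \<Rightarrow> 'v" and V
    using that resample_row_in[of R] by (simp add: space_table)
  hence "{R\<in>space Y. reaches E (Suc d) R} = {R\<in>space Y. R 0 \<in> E} \<union>
      (\<Union>B\<in>\<C>. {R\<in>space Y. R 0 \<in> occ B \<and> resample_row (var B) R \<in> {R\<in>space Y. reaches E d R}})"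
    by auto
  also have "\<dots> \<in> sets Y"
    using finite_bad by (intro sets.Un sets.finite_UN) measurable
  finally show ?case .
qed

text \<open>A union bound over \<open>j\<close> and the layerings of length \<open>d\<close>, with
  \<open>sum_weight_layerings\<close> for the sum over layerings. The bound is uniform in
  \<open>d\<close>, which permits the passage to unbounded runs.\<close>

lemma measure_reaches_le:
  fixes A :: "nat \<Rightarrow> 'v event"
  assumes A: "\<And>j. j \<in> {1..m} \<Longrightarrow> occ (A j) \<in> sets \<Omega>"
    and loc: "\<And>j. j \<in> {1..m} \<Longrightarrow> local_to (space \<Omega>) (var (A j)) (occ (A j))"
    and \<B>: "finite \<B>" "shearer \<Omega> \<B>" "\<C> \<subseteq> \<B>"
  shows "measure Y {R\<in>space Y. reaches (\<Union>j\<in>{1..m}. occ (A j)) d R}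
    \<le> (\<Sum>j=1..m. measure \<Omega> (occ (A j) - (\<Union>i\<in>{1..<j}. occ (A i))) * Psi \<Omega> \<B> \<C> (A j))"
proof -
  let ?D = "\<lambda>j. occ (A j) - (\<Union>i\<in>{1..<j}. occ (A i))"
  let ?U = "\<lambda>j. {B\<in>\<C>. var B \<inter> var (A j) \<noteq> {}}"
  let ?F = "\<lambda>j L. {R\<in>space Y. layer_legal (?D j) R (rev L)}"
  have D: "?D j \<in> sets \<Omega>" if "j \<in> {1..m}" for j
    using that by (intro sets.Diff sets.finite_UN A) auto
  have F: "?F j L \<in> sets Y" "measure Y (?F j L) = weight \<Omega> L * measure \<Omega> (?D j)"
    if "j \<in> {1..m}" "L \<in> layerings \<C> d (?U j)" for j L
    using measure_layer_legal[OF D[OF that(1)], of "rev L"] layerings_stable[OF that(2)]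
    by (auto simp: weight_rev)
  have fin: "finite (layerings \<C> d U)" for U by (rule finite_layerings[OF finite_bad])
  have sub: "{R\<in>space Y. reaches (\<Union>j\<in>{1..m}. occ (A j)) d R}
      \<subseteq> (\<Union>j\<in>{1..m}. \<Union>L\<in>layerings \<C> d (?U j). ?F j L)"
  proof
    fix R assume "R \<in> {R\<in>space Y. reaches (\<Union>j\<in>{1..m}. occ (A j)) d R}"
    hence R: "R \<in> space Y" and reach: "reaches (\<Union>j\<in>{1..m}. occ (A j)) d R" by auto
    obtain w where "set w \<subseteq> \<C>" "length w \<le> d" "legal (\<Union>j\<in>{1..m}. occ (A j)) R w"
      using reaches_word[OF reach] by blast
    hence "\<exists>j\<in>{1..m}. \<exists>L\<in>layerings \<C> d (?U j). layer_legal (?D j) R (rev L)"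
      using R loc by (intro layering_of_legal_word) (auto simp: space_table)
    thus "R \<in> (\<Union>j\<in>{1..m}. \<Union>L\<in>layerings \<C> d (?U j). ?F j L)" using R by blast
  qed
  have "measure Y {R\<in>space Y. reaches (\<Union>j\<in>{1..m}. occ (A j)) d R}
      \<le> measure Y (\<Union>j\<in>{1..m}. \<Union>L\<in>layerings \<C> d (?U j). ?F j L)"
    using sub F(1) fin by (intro table.P.finite_measure_mono sets.finite_UN) auto
  also have "\<dots> \<le> (\<Sum>j=1..m. measure Y (\<Union>L\<in>layerings \<C> d (?U j). ?F j L))"
    using F(1) fin by (intro measure_UNION_le sets.finite_UN) auto
  also have "\<dots> \<le> (\<Sum>j=1..m. \<Sum>L\<in>layerings \<C> d (?U j). measure Y (?F j L))"
    using F(1) fin by (intro sum_mono measure_UNION_le) auto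
  also have "\<dots> = (\<Sum>j=1..m. measure \<Omega> (?D j) * (\<Sum>L\<in>layerings \<C> d (?U j). weight \<Omega> L))"
    using F(2) by (intro sum.cong) (auto simp: sum_distrib_left mult.commute)
  also have "\<dots> \<le> (\<Sum>j=1..m. measure \<Omega> (?D j) * Psi \<Omega> \<B> \<C> (A j))"
  proof (intro sum_mono mult_left_mono)
    fix j
    have "?U j \<inter> \<C> = nbhd \<B> (A j) \<inter> \<C>" using \<B>(3) by (auto simp: nbhd_def dep_def)
    moreover have "{J. J \<subseteq> nbhd \<B> (A j) \<inter> \<C>} = Pow (nbhd \<B> (A j) \<inter> \<C>)" by auto
    ultimately show "(\<Sum>L\<in>layerings \<C> d (?U j). weight \<Omega> L) \<le> Psi \<Omega> \<B> \<C> (A j)"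
      using sum_weight_layerings[OF \<B>, of d "?U j"] by (simp add: Psi_def)
  qed auto
  finally show ?thesis .
qed

end

section \<open>The run as a function of its draws\<close>

lemma mt_config_0 [simp]: "mt_config \<B> r s y 0 = y 0"
  by (simp add: mt_config_def)

text \<open>Standing still after termination is expressed as resampling the empty set, so that both
  cases share one formula.\<close>

lemma mt_config_Suc:
  "mt_config \<B> r s y (Suc t) = override_on (mt_config \<B> r s y t) (y (Suc t))
    (if \<exists>B\<in>\<B>. mt_config \<B> r s y t \<in> occ B then var (r s (mt_history \<B> r s y t)) else {})"
  by (simp add: mt_config_def Let_def override_on_def)

lemma mt_history_eq: "mt_history \<B> r s y t = map (mt_config \<B> r s y) [0..<Suc t]"
proof (induction t)
  case (Suc t)
  have "mt_history \<B> r s y (Suc t) = mt_history \<B> r s y t @ [mt_config \<B> r s y (Suc t)]"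
    by (simp add: mt_config_def Let_def)
  thus ?case using Suc by simp
qed (simp add: mt_config_def)

lemma mt_history_cong:
  "(\<And>k. k \<le> t \<Longrightarrow> y k = y' k) \<Longrightarrow> mt_history \<B> r s y t = mt_history \<B> r s y' t"
  by (induction t) (simp_all add: Let_def)

lemma mt_config_cong:
  "(\<And>k. k \<le> t \<Longrightarrow> y k = y' k) \<Longrightarrow> mt_config \<B> r s y t = mt_config \<B> r s y' t"
  using mt_history_cong[of t y y' \<B> r s] by (simp add: mt_config_def)

text \<open>Here \<open>others\<close> is an exact inclusion; exceptional null sets must therefore
  already be part of \<open>E\<close>.\<close>

locale mt_run = resampling_space M I \<C> + S: prob_space S
  for M :: "nat \<Rightarrow> 'v measure" and I :: "nat set" and \<C> :: "'v event set" and S :: "'s measure" +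
  fixes \<B> :: "'v event set" and r :: "('s, 'v) rule" and E :: "'v config set"
  assumes finite_all: "finite \<B>" and sub: "\<C> \<subseteq> \<B>"
    and occ_all [measurable]: "B \<in> \<B> \<Longrightarrow> occ B \<in> sets (PiM I M)"
    and rule: "selection_rule (PiM I M) S \<B> r"
    and E [measurable]: "E \<in> sets (PiM I M)"
    and others: "B \<in> \<B> \<Longrightarrow> B \<notin> \<C> \<Longrightarrow> occ B \<subseteq> E"
begin

abbreviation "cfg \<equiv> mt_config \<B> r"

lemma measurable_selected:
  assumes "\<And>k. k \<le> t \<Longrightarrow> (\<lambda>\<omega>. cfg (fst \<omega>) (snd \<omega>) k) \<in> measurable (S \<Otimes>\<^sub>M Y) \<Omega>" and B: "B \<in> \<B>"
  shows "{\<omega>\<in>space (S \<Otimes>\<^sub>M Y). r (fst \<omega>) (mt_history \<B> r (fst \<omega>) (snd \<omega>) t) = B} \<in> sets (S \<Otimes>\<^sub>M Y)"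
proof -
  let ?N = "S \<Otimes>\<^sub>M (\<Pi>\<^sub>M k\<in>{..t}. \<Omega>)"
  let ?f = "\<lambda>\<omega>. (fst \<omega>, \<lambda>k\<in>{..t}. cfg (fst \<omega>) (snd \<omega>) k)"
  let ?A = "{(s, x) \<in> space ?N. r s (map x [0..<Suc t]) = B}"
  have A: "?A \<in> sets ?N" using rule B unfolding selection_rule_def by blast
  have f: "?f \<in> measurable (S \<Otimes>\<^sub>M Y) ?N"
    using assms(1) by (intro measurable_Pair measurable_fst measurable_restrict) auto
  have "map (\<lambda>k\<in>{..t}. cfg s y k) [0..<Suc t] = mt_history \<B> r s y t" for s y
    unfolding mt_history_eq by (intro map_cong) auto
  hence "{\<omega>\<in>space (S \<Otimes>\<^sub>M Y). r (fst \<omega>) (mt_history \<B> r (fst \<omega>) (snd \<omega>) t) = B}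
      = ?f -` ?A \<inter> space (S \<Otimes>\<^sub>M Y)"
    using measurable_space[OF f] by auto
  also have "\<dots> \<in> sets (S \<Otimes>\<^sub>M Y)" by (rule measurable_sets[OF f A])
  finally show ?thesis .
qed

lemma selected:
  assumes "s \<in> space S" "\<And>k. k \<le> t \<Longrightarrow> cfg s y k \<in> space \<Omega>" "\<exists>B\<in>\<B>. cfg s y t \<in> occ B"
  shows "r s (mt_history \<B> r s y t) \<in> \<B>" "cfg s y t \<in> occ (r s (mt_history \<B> r s y t))"
proof -
  let ?h = "mt_history \<B> r s y t"
  have last: "last ?h = cfg s y t" by (simp add: mt_config_def)
  have "?h \<noteq> [] \<and> set ?h \<subseteq> space \<Omega> \<and> (\<exists>B\<in>\<B>. last ?h \<in> occ B)"
    unfolding last using assms(2,3) by (auto simp: mt_history_eq)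
  moreover have "\<forall>h. h \<noteq> [] \<and> set h \<subseteq> space \<Omega> \<and> (\<exists>B\<in>\<B>. last h \<in> occ B) \<longrightarrow>
      r s h \<in> \<B> \<and> last h \<in> occ (r s h)"
    using rule assms(1) unfolding selection_rule_def by blast
  ultimately have "r s ?h \<in> \<B> \<and> last ?h \<in> occ (r s ?h)" by blast
  thus "r s ?h \<in> \<B>" "cfg s y t \<in> occ (r s ?h)" unfolding last by auto
qed

text \<open>The next configuration is one of finitely many measurable maps \<open>f b\<close>,
  chosen by the measurable selection \<open>g\<close>, where \<open>None\<close> stands for
  termination. The induction is strong because the rule reads all earlier configurations.\<close>

lemma measurable_config:
  "(\<lambda>\<omega>. cfg (fst \<omega>) (snd \<omega>) t) \<in> measurable (S \<Otimes>\<^sub>M Y) \<Omega>"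
proof (induction t rule: less_induct)
  case (less t)
  show ?case
  proof (cases t)
    case 0
    show ?thesis unfolding 0 mt_config_0 by measurable
  next
    case (Suc u)
    let ?X = "\<lambda>\<omega>. cfg (fst \<omega>) (snd \<omega>) u"
    let ?h = "\<lambda>\<omega>. mt_history \<B> r (fst \<omega>) (snd \<omega>) u"
    have cfg: "(\<lambda>\<omega>. cfg (fst \<omega>) (snd \<omega>) k) \<in> measurable (S \<Otimes>\<^sub>M Y) \<Omega>" if "k \<le> u" for k
      using less that Suc by simp
    note [measurable] = cfg[OF order_refl]
    define g where "g \<omega> = (if \<exists>B\<in>\<B>. ?X \<omega> \<in> occ B then Some (r (fst \<omega>) (?h \<omega>)) else None)" for \<omega>
    define f where "f b \<omega> = override_on (?X \<omega>) (snd \<omega> (Suc u)) (case b of None \<Rightarrow> {} | Some B \<Rightarrow> var B)"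
      for b :: "'v event option" and \<omega>
    let ?G = "insert None (Some ` \<B>)"
    have bad: "{\<omega>\<in>space (S \<Otimes>\<^sub>M Y). \<exists>B\<in>\<B>. ?X \<omega> \<in> occ B} \<in> sets (S \<Otimes>\<^sub>M Y)"
      using finite_all by measurable
    have "g \<in> measurable (S \<Otimes>\<^sub>M Y) (count_space ?G)"
    proof (subst measurable_count_space_eq2, use finite_all in simp, intro conjI ballI)
      show "g \<in> space (S \<Otimes>\<^sub>M Y) \<rightarrow> ?G"
      proof
        fix \<omega> assume "\<omega> \<in> space (S \<Otimes>\<^sub>M Y)"
        hence "fst \<omega> \<in> space S" "\<And>k. k \<le> u \<Longrightarrow> cfg (fst \<omega>) (snd \<omega>) k \<in> space \<Omega>"
          using measurable_space[OF cfg] by (auto simp: space_pair_measure)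
        thus "g \<omega> \<in> ?G" using selected(1) by (auto simp: g_def)
      qed
      fix b assume b: "b \<in> ?G"
      show "g -` {b} \<inter> space (S \<Otimes>\<^sub>M Y) \<in> sets (S \<Otimes>\<^sub>M Y)"
      proof (cases b)
        case None
        have "g -` {b} \<inter> space (S \<Otimes>\<^sub>M Y)
            = space (S \<Otimes>\<^sub>M Y) - {\<omega>\<in>space (S \<Otimes>\<^sub>M Y). \<exists>B\<in>\<B>. ?X \<omega> \<in> occ B}"
          by (auto simp: g_def None split: if_splits)
        thus ?thesis using bad by simp
      next
        case (Some B)
        hence "B \<in> \<B>" using b by auto
        have "g -` {b} \<inter> space (S \<Otimes>\<^sub>M Y) = {\<omega>\<in>space (S \<Otimes>\<^sub>M Y). \<exists>B\<in>\<B>. ?X \<omega> \<in> occ B}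
            \<inter> {\<omega>\<in>space (S \<Otimes>\<^sub>M Y). r (fst \<omega>) (?h \<omega>) = B}"
          by (auto simp: g_def Some split: if_splits)
        thus ?thesis using bad measurable_selected[OF cfg \<open>B \<in> \<B>\<close>] by auto
      qed
    qed
    hence "(\<lambda>\<omega>. f (g \<omega>) \<omega>) \<in> measurable (S \<Otimes>\<^sub>M Y) \<Omega>"
    proof (rule measurable_compose_countable'[rotated])
      show "(\<lambda>\<omega>. f b \<omega>) \<in> measurable (S \<Otimes>\<^sub>M Y) \<Omega>" for b
        unfolding f_def by measurable
      show "countable ?G" using finite_all by (simp add: countable_finite)
    qed
    moreover have "f (g \<omega>) \<omega> = cfg (fst \<omega>) (snd \<omega>) t" for \<omega>
      unfolding Suc mt_config_Suc f_def g_def by simp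
    ultimately show ?thesis by simp
  qed
qed

lemma measurable_config_seed:
  assumes "s \<in> space S"
  shows "(\<lambda>y. cfg s y t) \<in> measurable Y \<Omega>"
  using measurable_compose[OF measurable_Pair1'[OF assms] measurable_config[of t]] by simp

lemma config_in_space: "s \<in> space S \<Longrightarrow> y \<in> space Y \<Longrightarrow> cfg s y t \<in> space \<Omega>"
  using measurable_space[OF measurable_config_seed] by blast

text \<open>
  Before \<open>E\<close> is visited, the current configuration on top of the rows not yet drawn is a table whose
  rows below the top one are still independent of the past, and the next step of the algorithm is one of the steps that \<^const>\<open>reaches\<close> may choose.
\<close>

definition alive :: "nat \<Rightarrow> nat \<Rightarrow> 's \<Rightarrow> (nat \<Rightarrow> 'v config) \<Rightarrow> bool" where
  "alive N t s y \<longleftrightarrow> (\<exists>k\<le>t. cfg s y k \<in> E) \<or>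
     reaches E (N - t) (case_nat (cfg s y t) (\<lambda>k. y (Suc t + k)))"

lemma sets_alive:
  assumes s: "s \<in> space S"
  shows "{y\<in>space Y. alive N t s y} \<in> sets Y"
proof -
  note [measurable] = measurable_config_seed[OF s]
  let ?T = "{R\<in>space Y. reaches E (N - t) R}"
  let ?f = "\<lambda>y. case_nat (cfg s y t) (\<lambda>k. y (Suc t + k))"
  have f: "?f \<in> measurable Y Y"
    using measurable_case_nat'[OF measurable_config_seed[OF s]
        measurable_shift_rows[of "\<lambda>y. y" Y "\<lambda>k. Suc t + k"]] by simp
  have hit: "{y\<in>space Y. cfg s y k \<in> E} \<in> sets Y" for k by measurable
  have "{y\<in>space Y. alive N t s y} = (\<Union>k\<in>{..t}. {y\<in>space Y. cfg s y k \<in> E}) \<union> (?f -` ?T \<inter> space Y)"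
    using measurable_space[OF f] by (auto simp: alive_def)
  also have "\<dots> \<in> sets Y"
    using hit by (intro sets.Un sets.finite_UN measurable_sets[OF f sets_reaches[OF E]]) auto
  finally show ?thesis .
qed

text \<open>\<open>comb_seq t y w\<close> follows \<open>y\<close> for the first \<open>t\<close>
  draws and then continues with \<open>w\<close>; so, by Fubini, it is enough to compare
  probabilities conditioned on these draws.\<close>

lemma emeasure_comb_seq_mono:
  assumes A: "A \<in> sets Y" and B: "B \<in> sets Y"
    and le: "\<And>y. y \<in> space Y \<Longrightarrow> emeasure Y {w\<in>space Y. comb_seq t y w \<in> A} \<le> emeasure Y {w\<in>space Y. comb_seq t y w \<in> B}"
  shows "emeasure Y A \<le> emeasure Y B"
proof -
  let ?c = "\<lambda>(y, w). comb_seq t y w"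
  have c: "?c \<in> measurable (Y \<Otimes>\<^sub>M Y) Y" by (rule measurable_comb_seq)
  have eq: "emeasure Y F = (\<integral>\<^sup>+y. emeasure Y {w\<in>space Y. comb_seq t y w \<in> F} \<partial>Y)" if F: "F \<in> sets Y" for F
  proof -
    have "emeasure Y F = emeasure (distr (Y \<Otimes>\<^sub>M Y) Y ?c) F" by (simp only: table.PiM_comb_seq)
    also have "\<dots> = emeasure (Y \<Otimes>\<^sub>M Y) (?c -` F \<inter> space (Y \<Otimes>\<^sub>M Y))"
      by (rule emeasure_distr[OF c F])
    also have "\<dots> = (\<integral>\<^sup>+y. emeasure Y (Pair y -` (?c -` F \<inter> space (Y \<Otimes>\<^sub>M Y))) \<partial>Y)"
      by (rule table.P.emeasure_pair_measure_alt[OF measurable_sets[OF c F]])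
    also have "\<dots> = (\<integral>\<^sup>+y. emeasure Y {w\<in>space Y. comb_seq t y w \<in> F} \<partial>Y)"
      by (intro nn_integral_cong arg_cong[where f="emeasure Y"]) (auto simp: space_pair_measure)
    finally show ?thesis .
  qed
  show ?thesis unfolding eq[OF A] eq[OF B] by (rule nn_integral_mono[OF le])
qed

text \<open>Given the past, \<open>emeasure_fresh_row\<close> replaces the new draw by a resampling
  of the table that has the current configuration on top. If that resampled table reaches
  \<open>E\<close>, the current one does so with one more step.\<close>

lemma alive_step:
  assumes s: "s \<in> space S" and t: "t < N"
  shows "emeasure Y {y\<in>space Y. alive N (Suc t) s y} \<le> emeasure Y {y\<in>space Y. alive N t s y}"
\<comment> \<open>The configuration at time \<open>t\<close> depends on
  \<open>y 0, ..., y t\<close>, hence on \<open>Suc t\<close> draws.\<close>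
proof (rule emeasure_comb_seq_mono[where t="Suc t", OF sets_alive[OF s] sets_alive[OF s]])
  fix y assume y: "y \<in> space Y"
  let ?c = "comb_seq (Suc t) y"
  let ?x = "cfg s y t"
  define V where "V = (if \<exists>B\<in>\<B>. ?x \<in> occ B then var (r s (mt_history \<B> r s y t)) else {})"
  let ?R = "\<lambda>w. case_nat (override_on ?x (w 0) V) (\<lambda>k. w (Suc k))"
  let ?d = "N - Suc t"
  have x: "?x \<in> space \<Omega>" by (rule config_in_space[OF s y])
  have cY: "?c w \<in> space Y" if "w \<in> space Y" for w
    using that y by (simp add: space_table comb_seq_def)
  have past: "?c w k = y k" if "k \<le> t" for w k using that by (simp add: comb_seq_def)
  have fut: "(\<lambda>k. ?c w (Suc t + k)) = w" "(\<lambda>k. ?c w (Suc (Suc t) + k)) = (\<lambda>k. w (Suc k))"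
    "?c w (Suc t) = w 0" for w
    by (auto simp: comb_seq_def)
  have cfg: "cfg s (?c w) k = cfg s y k" if "k \<le> t" for w k
    using that past by (intro mt_config_cong) auto
  have hist: "mt_history \<B> r s (?c w) t = mt_history \<B> r s y t" for w
    using past by (intro mt_history_cong) auto
  have cfg_Suc: "cfg s (?c w) (Suc t) = override_on ?x (w 0) V" for w
    unfolding mt_config_Suc hist cfg[OF order_refl] fut V_def ..
  show "emeasure Y {w\<in>space Y. ?c w \<in> {y\<in>space Y. alive N (Suc t) s y}}
      \<le> emeasure Y {w\<in>space Y. ?c w \<in> {y\<in>space Y. alive N t s y}}"
  proof (cases "\<exists>k\<le>t. cfg s y k \<in> E")
    case True
    hence "alive N t s (?c w)" for w using cfg unfolding alive_def by metis
    hence "{w\<in>space Y. ?c w \<in> {y\<in>space Y. alive N t s y}} = space Y" using cY by auto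
    thus ?thesis by (simp add: emeasure_space)
  next
    case False
    let ?T = "{R\<in>space Y. reaches E ?d R}"
    have RY: "?R w \<in> space Y" if "w \<in> space Y" for w
      using cY[OF that] that cfg_Suc[of w] config_in_space[OF s cY[OF that], of "Suc t"]
      by (auto simp: space_table split: nat.split)
    have "alive N (Suc t) s (?c w) \<longleftrightarrow> reaches E ?d (?R w)" for w
    proof -
      have "(\<exists>k\<le>Suc t. cfg s (?c w) k \<in> E) \<longleftrightarrow> ?R w 0 \<in> E"
        using False cfg cfg_Suc by (auto simp: le_Suc_eq)
      thus ?thesis
        using reaches_now[of "?R w" E ?d] unfolding alive_def fut cfg_Suc by blast
    qed
    hence "{w\<in>space Y. ?c w \<in> {y\<in>space Y. alive N (Suc t) s y}} = {w\<in>space Y. ?R w \<in> ?T}"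
      using cY RY by auto
    hence "emeasure Y {w\<in>space Y. ?c w \<in> {y\<in>space Y. alive N (Suc t) s y}}
        = emeasure Y {w\<in>space Y. resample_row V (case_nat ?x w) \<in> ?T}"
      using emeasure_fresh_row[OF x sets_reaches[OF E], of V ?d] by simp
    also have "\<dots> \<le> emeasure Y {w\<in>space Y. ?c w \<in> {y\<in>space Y. alive N t s y}}"
    proof (rule emeasure_mono)
      show "{w\<in>space Y. resample_row V (case_nat ?x w) \<in> ?T}
          \<subseteq> {w\<in>space Y. ?c w \<in> {y\<in>space Y. alive N t s y}}"
      proof safe
        fix w assume w: "w \<in> space Y" and reach: "reaches E ?d (resample_row V (case_nat ?x w))"
        have Suc_d: "N - t = Suc ?d" using t by simp
        have "reaches E (Suc ?d) (case_nat ?x w)"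
        proof (cases "\<exists>B\<in>\<B>. ?x \<in> occ B")
          case True
          let ?B = "r s (mt_history \<B> r s y t)"
          have "?B \<in> \<B>" "?x \<in> occ ?B" using selected[OF s config_in_space[OF s y] True] .
          moreover have "?x \<notin> E" using False by auto
          \<comment> \<open>A selected event outside \<open>\<C>\<close> would put \<open>?x\<close>
            into \<open>E\<close>, which has not been visited yet.\<close>
          ultimately have "?B \<in> \<C>" using others[of ?B] by auto
          moreover have "V = var ?B" using True by (simp add: V_def)
          ultimately show ?thesis using reach \<open>?x \<in> occ ?B\<close> by auto
        next
          case False
          \<comment> \<open>After termination the table does not change, and one step of the budget
            is left over.\<close>
          hence "V = {}" by (simp add: V_def)
          thus ?thesis using reaches_Suc[of E ?d "case_nat ?x w"] reach by (simp only: resample_row_empty)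
        qed
        thus "alive N t s (?c w)" unfolding alive_def Suc_d fut cfg[OF order_refl] by (rule disjI2)
      qed (use cY in auto)
      have "?c \<in> measurable Y Y"
        using measurable_compose[OF measurable_Pair1'[OF y] measurable_comb_seq] by simp
      from measurable_sets[OF this sets_alive[OF s, of N t]]
      show "{w\<in>space Y. ?c w \<in> {y\<in>space Y. alive N t s y}} \<in> sets Y"
        by (rule back_subst[where P="\<lambda>A. A \<in> sets Y"]) auto
    qed
    finally show ?thesis .
  qed
qed

text \<open>\<open>alive_step\<close> is iterated from time \<open>N\<close> down to time 0, where
  the table consists of the draws themselves.\<close>

lemma emeasure_hits_le:
  assumes s: "s \<in> space S"
  shows "emeasure Y {y\<in>space Y. \<exists>k\<le>N. cfg s y k \<in> E} \<le> emeasure Y {R\<in>space Y. reaches E N R}"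
proof -
  have "emeasure Y {y\<in>space Y. alive N t s y} \<le> emeasure Y {y\<in>space Y. alive N 0 s y}" if "t \<le> N" for t
    using that
  proof (induction t)
    case (Suc t)
    show ?case
      using order_trans[OF alive_step[OF s, of t N] Suc.IH] Suc.prems by simp
  qed simp
  hence "emeasure Y {y\<in>space Y. alive N N s y} \<le> emeasure Y {y\<in>space Y. alive N 0 s y}" by simp
  moreover have "emeasure Y {y\<in>space Y. \<exists>k\<le>N. cfg s y k \<in> E} \<le> emeasure Y {y\<in>space Y. alive N N s y}"
    by (intro emeasure_mono sets_alive[OF s]) (auto simp: alive_def)
  moreover have "alive N 0 s y \<longleftrightarrow> reaches E N y" for y
  proof -
    have "case_nat (y 0) (\<lambda>k. y (Suc k)) = y" by (auto simp: fun_eq_iff split: nat.split)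
    thus ?thesis using reaches_now[of y E N] by (auto simp: alive_def)
  qed
  ultimately show ?thesis by simp
qed

text \<open>For a fixed seed the visits up to time \<open>N\<close> increase with \<open>N\<close>,
  so the uniform bound \<open>c\<close> survives the limit; integration over the seed preserves
  it.\<close>

lemma measure_hits_le:
  assumes c: "\<And>N. measure Y {R\<in>space Y. reaches E N R} \<le> c"
  shows "{(s, y)\<in>space (S \<Otimes>\<^sub>M Y). \<exists>t. cfg s y t \<in> E} \<in> sets (S \<Otimes>\<^sub>M Y)"
    and "measure (S \<Otimes>\<^sub>M Y) {(s, y)\<in>space (S \<Otimes>\<^sub>M Y). \<exists>t. cfg s y t \<in> E} \<le> c"
proof -
  note [measurable] = measurable_config
  let ?H = "{\<omega>\<in>space (S \<Otimes>\<^sub>M Y). \<exists>t. cfg (fst \<omega>) (snd \<omega>) t \<in> E}"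
  have H: "?H \<in> sets (S \<Otimes>\<^sub>M Y)" by measurable
  have eq: "{(s, y)\<in>space (S \<Otimes>\<^sub>M Y). \<exists>t. cfg s y t \<in> E} = ?H" by auto
  show "{(s, y)\<in>space (S \<Otimes>\<^sub>M Y). \<exists>t. cfg s y t \<in> E} \<in> sets (S \<Otimes>\<^sub>M Y)" unfolding eq by (rule H)
  have c0: "0 \<le> c" using c[of 0] measure_nonneg order_trans by blast
  have sec: "emeasure Y (Pair s -` ?H) \<le> ennreal c" if s: "s \<in> space S" for s
  proof -
    note [measurable] = measurable_config_seed[OF s]
    let ?A = "\<lambda>N. {y\<in>space Y. \<exists>k\<le>N. cfg s y k \<in> E}"
    have A: "?A N \<in> sets Y" for N by measurable
    have "Pair s -` ?H = (\<Union>N. ?A N)" using s by (auto simp: space_pair_measure)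
    hence "emeasure Y (Pair s -` ?H) = (SUP N. emeasure Y (?A N))"
      using A by (subst SUP_emeasure_incseq) (auto simp: incseq_def intro: order_trans)
    also have "\<dots> \<le> ennreal c"
    proof (rule SUP_least)
      fix N
      have "emeasure Y (?A N) \<le> ennreal (measure Y {R\<in>space Y. reaches E N R})"
        using emeasure_hits_le[OF s, of N] by (simp add: table.P.emeasure_eq_measure)
      also have "\<dots> \<le> ennreal c" using c by (intro ennreal_leI)
      finally show "emeasure Y (?A N) \<le> ennreal c" .
    qed
    finally show ?thesis .
  qed
  have "emeasure (S \<Otimes>\<^sub>M Y) ?H = (\<integral>\<^sup>+s. emeasure Y (Pair s -` ?H) \<partial>S)"
    by (rule table.P.emeasure_pair_measure_alt[OF H])
  also have "\<dots> \<le> (\<integral>\<^sup>+s. ennreal c \<partial>S)" by (intro nn_integral_mono sec)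
  also have "\<dots> = ennreal c" by (simp add: S.emeasure_space_1)
  finally show "measure (S \<Otimes>\<^sub>M Y) {(s, y)\<in>space (S \<Otimes>\<^sub>M Y). \<exists>t. cfg s y t \<in> E} \<le> c"
    unfolding eq measure_def using c0 by (simp add: enn2real_leI)
qed

end

lemma is_event_local_to: "is_event n \<Omega> E \<Longrightarrow> local_to (space \<Omega>) (var E) (occ E)"
  unfolding is_event_def local_to_def by (elim conjE)

text \<open>
  Bad-events outside \<open>\<B>[E]\<close> are contained in \<open>E\<close> only up to a null set. That null set is treated as
  one further target event, which contributes nothing to the sum because its probability is \<open>0\<close>.
\<close>

theorem proposition3p4:
  fixes n m :: nat
    and M :: "nat \<Rightarrow> 'v measure"
    and \<Omega> :: "(nat \<Rightarrow> 'v) measure"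
    and \<B> \<A> :: "'v event set"
    and A :: "nat \<Rightarrow> 'v event"
    and S :: "'s measure"
    and r :: "('s, 'v) rule"
  assumes "\<And>i. i \<in> {1..n} \<Longrightarrow> prob_space (M i)"
    and "\<Omega> = (\<Pi>\<^sub>M i\<in>{1..n}. M i)"
    and "finite \<B>" and "\<And>B. B \<in> \<B> \<Longrightarrow> is_event n \<Omega> B"
    and "shearer \<Omega> \<B>"
    and "\<And>E. E \<in> \<A> \<Longrightarrow> is_event n \<Omega> E" and "bij_betw A {1..m} \<A>"
    and "prob_space S" and "selection_rule \<Omega> S \<B> r"
  shows "mt_prob \<Omega> S \<B> r (Disj \<A>) \<le>
    (\<Sum>j=1..m. measure \<Omega> (occ (A j) - (\<Union>i\<in>{1..<j}. occ (A i))) *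
                Psi \<Omega> \<B> (restrict_bad \<Omega> \<B> (Disj \<A>)) (A j))"
proof -
  \<comment> \<open>\<open>M\<close> is specified only on \<open>{1..n}\<close>, while the product
    locale asks for a probability space at every index; a one-point space fills the gap.\<close>
  define M' where "M' i = (if i \<in> {1..n} then M i else count_space {undefined})" for i
  have prob: "prob_space (M' i)" for i
    using assms(1) by (cases "i \<in> {1..n}") (auto simp: M'_def intro!: prob_spaceI)
  have \<Omega>: "\<Omega> = PiM {1..n} M'"
    unfolding assms(2) by (intro PiM_cong) (auto simp: M'_def)
  interpret M': product_prob_space M' "{1..n}"
    using prob by (intro product_prob_space.intro product_sigma_finite.intro product_prob_space_axioms.intro)
      (auto intro: prob_space_imp_sigma_finite)
  interpret \<Omega>: prob_space \<Omega> unfolding \<Omega> by (rule prob_space_PiM) (rule prob)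
  define E where "E = occ (Disj \<A>)"
  define \<C> where "\<C> = restrict_bad \<Omega> \<B> (Disj \<A>)"
  define N where "N = (\<Union>B\<in>\<B> - \<C>. occ B - E)"
  \<comment> \<open>The null set is put last, so the differences for the earlier targets stay as
    they are. With all of \<open>{1..n}\<close> as variable set, its locality is immediate.\<close>
  define A' where "A' = A(Suc m := Event N {1..n})"
  have ev: "is_event n \<Omega> (A j)" if "j \<in> {1..m}" for j
    using that assms(6) bij_betwE[OF assms(7)] by blast
  have E_eq: "E = (\<Union>j\<in>{1..m}. occ (A j))"
    using bij_betw_imp_surj_on[OF assms(7)] by (force simp: E_def Disj_def)
  have sets_B [measurable]: "occ B \<in> sets \<Omega>" if "B \<in> \<B>" for B
    using assms(4)[OF that] by (simp add: is_event_def)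
  have sets_E [measurable]: "E \<in> sets \<Omega>"
    unfolding E_eq using ev by (intro sets.finite_UN) (auto simp: is_event_def)
  have sets_N [measurable]: "N \<in> sets \<Omega>"
    unfolding N_def using assms(3) sets_B by (intro sets.finite_UN sets.Diff) auto
  have CB: "\<C> \<subseteq> \<B>" by (auto simp: \<C>_def restrict_bad_def)

  have null: "measure \<Omega> (occ B - E) = 0" if B: "B \<in> \<B> - \<C>" for B
  proof -
    have BS: "occ B \<in> sets \<Omega>" using B sets_B by auto
    have sp: "{x\<in>space \<Omega>. x \<in> E \<and> x \<in> occ B} = occ B \<inter> E" "{x\<in>space \<Omega>. x \<in> occ B} = occ B"
      using sets.sets_into_space[OF BS] by auto
    \<comment> \<open>Outside \<open>\<C>\<close> the conditional probability is not below 1, so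
      \<open>E\<close> covers \<open>occ B\<close> up to measure 0.\<close>
    have "1 \<le> measure \<Omega> (occ B \<inter> E) / measure \<Omega> (occ B)"
      using B sp unfolding \<C>_def restrict_bad_def cond_prob_def E_def[symmetric] by auto
    hence "measure \<Omega> (occ B) \<le> measure \<Omega> (occ B \<inter> E)"
      by (cases "measure \<Omega> (occ B) = 0") (auto simp: le_divide_eq split: if_splits)
    moreover have "measure \<Omega> (occ B - E) = measure \<Omega> (occ B) - measure \<Omega> (occ B \<inter> E)"
      using \<Omega>.finite_measure_Diff'[OF BS sets_E] .
    ultimately show ?thesis using measure_nonneg[of \<Omega> "occ B - E"] by linarith
  qed
  have N0: "measure \<Omega> N = 0"
  proof -
    have "measure \<Omega> N \<le> (\<Sum>B\<in>\<B> - \<C>. measure \<Omega> (occ B - E))"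
      unfolding N_def using assms(3) sets_B sets_E by (intro measure_UNION_le) auto
    thus ?thesis using null measure_nonneg[of \<Omega> N] by simp
  qed

  interpret mt_run M' "{1..n}" \<C> S \<B> r "E \<union> N"
  proof (intro mt_run.intro resampling_space.intro variable_space.intro finite_product_prob_space.intro
      finite_product_sigma_finite.intro resampling_space_axioms.intro mt_run_axioms.intro
      finite_product_sigma_finite_axioms.intro assms(8))
    show "product_prob_space M'" "product_sigma_finite M'" by unfold_locales
    show "finite \<C>" using CB assms(3) finite_subset by auto
    show "occ B \<in> sets (PiM {1..n} M')" if "B \<in> \<C>" for B unfolding \<Omega>[symmetric] using that CB sets_B by auto
    show "local_to (space (PiM {1..n} M')) (var B) (occ B)" if "B \<in> \<C>" for B
      unfolding \<Omega>[symmetric] using that CB assms(4) by (intro is_event_local_to) auto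
    show "selection_rule (PiM {1..n} M') S \<B> r" unfolding \<Omega>[symmetric] by (rule assms(9))
    show "E \<union> N \<in> sets (PiM {1..n} M')" unfolding \<Omega>[symmetric] by simp
    show "occ B \<in> sets (PiM {1..n} M')" if "B \<in> \<B>" for B unfolding \<Omega>[symmetric] using that sets_B by simp
    show "occ B \<subseteq> E \<union> N" if "B \<in> \<B>" "B \<notin> \<C>" for B using that by (auto simp: N_def)
  qed (use assms(3) CB in auto)

  \<comment> \<open>The sum with the additional target\<close>
  let ?s = "\<lambda>m A. \<Sum>j=1..m. measure \<Omega> (occ (A j) - (\<Union>i\<in>{1..<j}. occ (A i))) * Psi \<Omega> \<B> \<C> (A j)"
  have A'_old: "A' j = A j" if "j \<in> {1..m}" for j using that by (auto simp: A'_def)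
  have EN: "E \<union> N = (\<Union>j\<in>{1..Suc m}. occ (A' j))"
    by (auto simp: E_eq atLeastAtMostSuc_conv A'_def)
  have sets_A': "occ (A' j) \<in> sets \<Omega>" if "j \<in> {1..Suc m}" for j
    using that ev[of j] by (auto simp: A'_def is_event_def)
  have local_A': "local_to (space \<Omega>) (var (A' j)) (occ (A' j))" if "j \<in> {1..Suc m}" for j
  proof (cases "j = Suc m")
    case True
    have "x = y" if "x \<in> space \<Omega>" "y \<in> space \<Omega>" "\<forall>i\<in>{1..n}. x i = y i" for x y
      using that unfolding \<Omega> space_PiM by (intro PiE_ext[of x _ _ y]) auto
    thus ?thesis using True by (auto simp: A'_def local_to_def)
  next
    case False
    thus ?thesis using that ev[of j] A'_old[of j] is_event_local_to by auto
  qed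
  have "?s (Suc m) A' = ?s m A' + measure \<Omega> (N - (\<Union>i\<in>{1..<Suc m}. occ (A' i))) * Psi \<Omega> \<B> \<C> (A' (Suc m))"
    by (simp add: A'_def)
  also have "measure \<Omega> (N - (\<Union>i\<in>{1..<Suc m}. occ (A' i))) = 0"
    using \<Omega>.finite_measure_mono[OF _ sets_N, of "N - (\<Union>i\<in>{1..<Suc m}. occ (A' i))"] N0
      measure_nonneg[of \<Omega>] by (metis Diff_subset order_antisym)
  also have "?s m A' = ?s m A"
    using A'_old by (intro sum.cong refl arg_cong2[where f="(*)"] arg_cong[where f="measure \<Omega>"]) auto
  finally have sum: "?s (Suc m) A' = ?s m A" by simp

  have "measure (\<Pi>\<^sub>M t\<in>(UNIV::nat set). \<Omega>) {R\<in>space (\<Pi>\<^sub>M t\<in>(UNIV::nat set). \<Omega>). reaches (E \<union> N) d R}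
      \<le> ?s (Suc m) A'" for d
    using assms(3,5) CB sets_A' local_A' unfolding \<Omega> EN by (intro measure_reaches_le)
  hence reach: "measure Y {R\<in>space Y. reaches (E \<union> N) d R} \<le> ?s m A" for d
    unfolding sum by (simp only: \<Omega>)

  interpret run: prob_space "S \<Otimes>\<^sub>M Y"
    by (intro prob_space_pair S.prob_space_axioms table.P.prob_space_axioms)
  \<comment> \<open>A run that stops with the target true has visited it, so the event defining
    \<open>mt_prob\<close> lies inside a visit to \<open>E \<union> N\<close>.\<close>
  have "mt_prob \<Omega> S \<B> r (Disj \<A>) \<le>
      measure (S \<Otimes>\<^sub>M Y) {(s, y)\<in>space (S \<Otimes>\<^sub>M Y). \<exists>t. mt_config \<B> r s y t \<in> E \<union> N}"
    unfolding mt_prob_def E_def[symmetric] \<Omega>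
    by (intro run.finite_measure_mono measure_hits_le(1)[OF reach]) auto
  also have "\<dots> \<le> ?s m A" by (rule measure_hits_le(2)[OF reach])
  finally show ?thesis unfolding \<C>_def .
qed

end
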